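(* Let $n\ge 1$ and let $f\in\mathcal{B}_{P(n,1)}$. Then, for all $z_1,z_2\in\mathbb{B}^n$, $$\left|D_f^{n,1}(z_2)-D_f^{n,1}(z_1)\right|\leq M(n)\,\|f\|_{P(n,1)}\,\big[\tanh\beta(z_1,z_2)\big]^{\frac1n},$$ where $$M(n)=(n+2)^{\frac{1}{2n}}\left(\frac{n+2}{n+1}\right)^{\frac{n+1}{2n}}.$$
   Context: $\mathbb{B}^n=\{z\in\mathbb{C}^n:|z|<1\}$ is the open unit ball of $\mathbb{C}^n$ ($n\ge1$) with the standard Hermitian inner product $\langle z,w\rangle=\sum_i z_i\overline{w_i}$ and Euclidean norm $|z|$. A mapping $f:\mathbb{B}^n\to\mathbb{C}^n$ is pluriharmonic if it is twice continuously differentiable and $\frac{\partial^2 f}{\partial z_i\partial\overline{z}_j}=0$ on $\mathbb{B}^n$ for all $i,j=1,\dots,n$ (componentwise). $\mathcal{H}(\mathbb{B}^n,\mathbb{C}^n)$ denotes the set of all such mappings. Every $f\in\mathcal{H}(\mathbb{B}^n,\mathbb{C}^n)$ can be written as $f=h+\overline{g}$ with $h,g:\mathbb{B}^n\to\mathbb{C}^n$ holomorphic, uniquely if $g(0)=0$. Let $Dh(z),Dg(z)$ be the complex $n\times n$ Jacobian matrices. Define $$\Lambda_f(z)=|\det Dh(z)|+|\det Dg(z)|,\qquad D_f^{n,1}(z)=(1-|z|^2)^{\frac{n+1}{2n}}\Lambda_f(z)^{\frac1n},\qquad \|f\|_{P(n,1)}=\sup_{z\in\mathbb{B}^n}D_f^{n,1}(z).$$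 $\mathcal{B}_{P(n,1)}$ is the set of $f\in\mathcal{H}(\mathbb{B}^n,\mathbb{C}^n)$ with $\|f\|_{P(n,1)}<\infty$ (the quantity $\|\cdot\|_{P(n,1)}$ is only called a prenorm; no linear structure is assumed). Bergman metric: for $z\in\mathbb{B}^n$ let $B(z)=\frac{(1-|z|^2)I+A(z)}{(1-|z|^2)^2}$, where $I$ is the $n\times n$ identity matrix and $A(z)=(z_i\overline{z}_j)_{i,j}$. Then $\beta(z,w)=\inf_\gamma\int_0^1\langle B(\gamma(t))\gamma'(t),\gamma'(t)\rangle^{1/2}\,dt$, the infimum being over piecewise smooth curves $\gamma:[0,1]\to\mathbb{B}^n$ connecting $z$ and $w$. Equivalently, $\tanh\beta(z,w)=|\varphi_z(w)|$, where $\varphi_z$ is the involutive automorphism of $\mathbb{B}^n$ interchanging $0$ and $z$: $$\varphi_z(w)=\frac{z-P_zw-\sqrt{1-|z|^2}\,Q_zw}{1-\langle w,z\rangle},$$ with $P_z$ the orthogonal projection of $\mathbb{C}^n$ onto the span of $z$ and $Q_z=I-P_z$. *)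

theory Defs
  imports "HOL-Analysis.Analysis"
begin

text \<open>The unit ball of complex n-space is the library's \<open>ball 0 1\<close> in \<open>complex ^ 'n\<close> (whose norm is
  the Euclidean one), with \<open>n = CARD('n)\<close>. Maps on the ball are total functions on \<open>complex ^ 'n\<close>;
  only their values on the ball matter below.\<close>

definition hinner :: "complex ^ 'n \<Rightarrow> complex ^ 'n \<Rightarrow> complex" where
  "hinner z w = (\<Sum>i\<in>UNIV. z $ i * cnj (w $ i))"

definition cnj_vec :: "complex ^ 'n \<Rightarrow> complex ^ 'n" where
  "cnj_vec z = (\<chi> i. cnj (z $ i))"

definition C2_on :: "('a::real_normed_vector \<Rightarrow> 'b::real_normed_vector) \<Rightarrow> 'a set \<Rightarrow> bool" where
  "C2_on f S \<longleftrightarrow>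
    (\<exists>(f' :: 'a \<Rightarrow> 'a \<Rightarrow>\<^sub>L 'b) (f'' :: 'a \<Rightarrow> 'a \<Rightarrow>\<^sub>L 'a \<Rightarrow>\<^sub>L 'b).
      (\<forall>z\<in>S. (f has_derivative blinfun_apply (f' z)) (at z)) \<and>
      (\<forall>z\<in>S. (f' has_derivative blinfun_apply (f'' z)) (at z)) \<and>
      continuous_on S f'')"

definition dir_deriv :: "complex ^ 'n \<Rightarrow> (complex ^ 'n \<Rightarrow> complex) \<Rightarrow> complex ^ 'n \<Rightarrow> complex" where
  "dir_deriv v u z = vector_derivative (\<lambda>t. u (z + t *\<^sub>R v)) (at 0)"

text \<open>Wirtinger derivatives: \<open>axis j 1\<close> and \<open>axis j \<i>\<close> are the directions of the real coordinates
  \<open>x\<^sub>j\<close> and \<open>y\<^sub>j\<close> of \<open>z\<^sub>j = x\<^sub>j + \<i> y\<^sub>j\<close>.\<close>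

definition wirtinger :: "'n \<Rightarrow> (complex ^ 'n \<Rightarrow> complex) \<Rightarrow> complex ^ 'n \<Rightarrow> complex" where
  "wirtinger j u z = (dir_deriv (axis j 1) u z - \<i> * dir_deriv (axis j \<i>) u z) / 2"

definition wirtinger_bar :: "'n \<Rightarrow> (complex ^ 'n \<Rightarrow> complex) \<Rightarrow> complex ^ 'n \<Rightarrow> complex" where
  "wirtinger_bar j u z = (dir_deriv (axis j 1) u z + \<i> * dir_deriv (axis j \<i>) u z) / 2"

definition pluriharmonic_maps :: "(complex ^ 'n \<Rightarrow> complex ^ 'n) set" where
  "pluriharmonic_maps = {f. C2_on f (ball 0 1) \<and>
     (\<forall>i j k. \<forall>z\<in>ball 0 1. wirtinger i (wirtinger_bar j (\<lambda>w. f w $ k)) z = 0)}"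

text \<open>Complex differentiability: the Frechet derivative is complex linear.\<close>

definition holomorphic_map_on :: "(complex ^ 'n \<Rightarrow> complex ^ 'n) \<Rightarrow> (complex ^ 'n) set \<Rightarrow> bool" where
  "holomorphic_map_on h S \<longleftrightarrow>
    (\<forall>z\<in>S. \<exists>A :: complex ^ 'n ^ 'n. (h has_derivative (\<lambda>v. A *v v)) (at z))"

definition jacobian :: "(complex ^ 'n \<Rightarrow> complex ^ 'n) \<Rightarrow> complex ^ 'n \<Rightarrow> complex ^ 'n ^ 'n" where
  "jacobian h z = (\<chi> i j. deriv (\<lambda>\<zeta>. h (z + \<zeta> *s axis j 1) $ i) 0)"

definition canonical_decomposition ::
  "(complex ^ 'n \<Rightarrow> complex ^ 'n) \<Rightarrow> (complex ^ 'n \<Rightarrow> complex ^ 'n) \<times> (complex ^ 'n \<Rightarrow> complex ^ 'n) \<Rightarrow> bool"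
where
  "canonical_decomposition f = (\<lambda>(h, g).
     holomorphic_map_on h (ball 0 1) \<and> holomorphic_map_on g (ball 0 1) \<and> g 0 = 0 \<and>
     (\<forall>z\<in>ball 0 1. f z = h z + cnj_vec (g z)))"

text \<open>For pluriharmonic \<open>f\<close> such a pair exists, and its values on the ball are unique. \<open>SOME\<close>, not
  \<open>THE\<close>, is needed because the values outside the ball are arbitrary; they do not affect \<open>Lambda\<close>
  on the ball.\<close>

definition pluri_parts ::
  "(complex ^ 'n \<Rightarrow> complex ^ 'n) \<Rightarrow> (complex ^ 'n \<Rightarrow> complex ^ 'n) \<times> (complex ^ 'n \<Rightarrow> complex ^ 'n)"
where
  "pluri_parts f = (SOME p. canonical_decomposition f p)"

definition Lambda :: "(complex ^ 'n \<Rightarrow> complex ^ 'n) \<Rightarrow> complex ^ 'n \<Rightarrow> real" where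
  "Lambda f z = (case pluri_parts f of (h, g) \<Rightarrow>
     cmod (det (jacobian h z)) + cmod (det (jacobian g z)))"

definition Dn1 :: "(complex ^ 'n \<Rightarrow> complex ^ 'n) \<Rightarrow> complex ^ 'n \<Rightarrow> real" where
  "Dn1 f z = (1 - (norm z)\<^sup>2) powr ((real CARD('n) + 1) / (2 * real CARD('n)))
             * Lambda f z powr (1 / real CARD('n))"

definition bloch_prenorm :: "(complex ^ 'n \<Rightarrow> complex ^ 'n) \<Rightarrow> real" where
  "bloch_prenorm f = (SUP z\<in>ball 0 1. Dn1 f z)"

text \<open>The supremum is real-valued; its finiteness is expressed by \<open>bdd_above\<close>.\<close>

definition bloch_space :: "(complex ^ 'n \<Rightarrow> complex ^ 'n) set" where
  "bloch_space = {f \<in> pluriharmonic_maps. bdd_above (Dn1 f ` ball 0 1)}"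

definition bergman_matrix :: "complex ^ 'n \<Rightarrow> complex ^ 'n ^ 'n" where
  "bergman_matrix z = (\<chi> i j. (of_real (1 - (norm z)\<^sup>2) * mat 1 $ i $ j + z $ i * cnj (z $ j))
                               / of_real ((1 - (norm z)\<^sup>2)\<^sup>2))"

text \<open>Piecewise continuously differentiable curves on \<open>{0..1}\<close>, with derivatives continuous up to the
  break points. The library's \<open>valid_path\<close> is too weak here: it allows the derivative to blow up
  at the break points, so that the length may be infinite, in which case the Henstock-Kurzweil
  \<open>integral\<close> would be 0 by convention.\<close>

definition piecewise_smooth_curve :: "(real \<Rightarrow> 'a::real_normed_vector) \<Rightarrow> bool" where
  "piecewise_smooth_curve \<gamma> \<longleftrightarrow> path \<gamma> \<and>
    (\<exists>S. finite S \<and> {0, 1} \<subseteq> S \<and> S \<subseteq> {0..1} \<and>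
      (\<forall>a\<in>S. \<forall>b\<in>S. a < b \<and> {a<..<b} \<inter> S = {} \<longrightarrow>
        (\<exists>\<gamma>'. continuous_on {a..b} \<gamma>' \<and>
              (\<forall>t\<in>{a..b}. (\<gamma> has_vector_derivative \<gamma>' t) (at t within {a..b})))))"

definition bergman_length :: "(real \<Rightarrow> complex ^ 'n) \<Rightarrow> real" where
  "bergman_length \<gamma> = integral {0..1} (\<lambda>t.
     let v = vector_derivative \<gamma> (at t)
     in sqrt (Re (hinner (bergman_matrix (\<gamma> t) *v v) v)))"

definition bergman_dist :: "complex ^ 'n \<Rightarrow> complex ^ 'n \<Rightarrow> real" where
  "bergman_dist z w = Inf (bergman_length ` {\<gamma>. piecewise_smooth_curve \<gamma> \<and>
     path_image \<gamma> \<subseteq> ball 0 1 \<and> pathstart \<gamma> = z \<and> pathfinish \<gamma> = w})"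

definition M_const :: "nat \<Rightarrow> real" where
  "M_const n = (real n + 2) powr (1 / (2 * real n))
             * ((real n + 2) / (real n + 1)) powr ((real n + 1) / (2 * real n))"

end

theory Submission
  imports Defs "HOL-Complex_Analysis.Riemann_Mapping"
begin

text \<open>The \<open>n\<close>-th power of \<open>Dn1 f z\<close> is \<open>(1 - \<bar>z\<bar>\<^sup>2)\<close> to the power \<open>(n + 1) / 2\<close> times the maximum over unimodular
  \<open>c\<close> of \<open>\<bar>u z\<bar>\<close>, where \<open>u = det Dh + c det Dg\<close> is holomorphic. The weighted modulus of such a \<open>u\<close>
  transforms well under the automorphisms of the complex disc in which the line through \<open>z1\<close> and
  \<open>z2\<close> meets the ball, so \<open>z1\<close> may be moved to the centre of the disc; there the Schwarz--Pick
  lemma on the concentric disc of radius \<open>1 / sqrt (n + 2)\<close> bounds the increment by the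
  pseudohyperbolic distance of \<open>z1\<close> and \<open>z2\<close>. Finally, the \<open>cosh\<close> of the invariant distance grows
  along a curve no faster than the Bergman length of the curve allows, so the pseudohyperbolic
  distance is at most \<open>tanh (bergman_dist z1 z2)\<close>.\<close>

text \<open>\<open>Lambda\<close> reads off a pair selected by \<open>SOME\<close>, so nothing is
  known of it until a decomposition of \<open>f\<close> is shown to exist. The complex linear part
  of the derivative of \<open>f\<close> is a closed form because the mixed second derivatives
  vanish; its primitive is the holomorphic part \<open>h\<close>, and what remains of
  \<open>f\<close> is conjugate holomorphic. The exponent 1/n in the claim comes from undoing the
  n-th power: |A - B|^n <= |A^n - B^n| for nonnegative A and B. Accordingly M(n)^n is the
  Schwarz--Pick constant 1 / (R (1 - R^2)^((n+1)/2)) at R = 1 / sqrt (n + 2), the radius at which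
  this expression is least. Both points lie on one complex line, so one-variable theory suffices
  once the determinants are known to be holomorphic along lines. The relation between the Bergman
  and the pseudohyperbolic distance enters as an inequality, obtained without geodesics by bounding
  the length of every curve from below.\<close>

section \<open>Pluriharmonic maps\<close>

text \<open>Here \<open>F\<close> stands for the derivative of \<open>f'\<close> at the single point
  \<open>x\<close>. Both \<open>f' (x + r *\<^sub>R u + s *\<^sub>R v)\<close> and
  \<open>f' (x + r *\<^sub>R u)\<close> are compared with the linear approximation of
  \<open>f'\<close> at \<open>x\<close>; the two errors make up the factor 2.\<close>

lemma second_difference_bound:
  fixes f :: "'a::real_normed_vector \<Rightarrow> 'b::real_normed_vector" and f' :: "'a \<Rightarrow> 'a \<Rightarrow>\<^sub>L 'b"
  assumes f: "\<And>w. norm (w - x) < d \<Longrightarrow> (f has_derivative blinfun_apply (f' w)) (at w)"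
    and f': "\<And>w. norm (w - x) < d \<Longrightarrow> norm (f' w - f' x - F (w - x)) \<le> e * norm (w - x)"
    and F: "linear F"
    and s: "0 < s" "s * (norm u + norm v) < d" and e: "0 \<le> e"
  shows "norm (f (x + s *\<^sub>R u + s *\<^sub>R v) - f (x + s *\<^sub>R u) - f (x + s *\<^sub>R v) + f x
           - s\<^sup>2 *\<^sub>R F v u) \<le> 2 * e * (norm u + norm v) * norm u * s\<^sup>2"
proof -
  define N where "N = norm u + norm v"
  define g where "g r = f (x + r *\<^sub>R u + s *\<^sub>R v) - f (x + r *\<^sub>R u)" for r :: real
  define g' where "g' r = f' (x + r *\<^sub>R u + s *\<^sub>R v) - f' (x + r *\<^sub>R u)" for r :: real
  have near: "norm (r *\<^sub>R u + t *\<^sub>R v) \<le> s * N" if "r \<in> {0..s}" "t \<in> {0..s}" for r t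
  proof -
    have "norm (r *\<^sub>R u + t *\<^sub>R v) \<le> r * norm u + t * norm v"
      using that by (intro norm_triangle_le) auto
    also have "\<dots> \<le> s * N"
      unfolding N_def distrib_left using that by (intro add_mono mult_right_mono) auto
    finally show ?thesis .
  qed
  have pos: "0 \<in> {0..s}" "s \<in> {0..s}" using s by auto
  have der: "(g has_derivative (\<lambda>h. h *\<^sub>R g' r u)) (at r within {0..s})" if r: "r \<in> {0..s}" for r
  proof -
    have 1: "norm ((x + r *\<^sub>R u + s *\<^sub>R v) - x) < d" "norm ((x + r *\<^sub>R u) - x) < d"
      using near[OF r pos(2)] near[OF r pos(1)] s(2) by (auto simp: N_def add.assoc)
    have "((\<lambda>r. f (x + r *\<^sub>R u + s *\<^sub>R v)) has_derivative
            (\<lambda>h. blinfun_apply (f' (x + r *\<^sub>R u + s *\<^sub>R v)) (h *\<^sub>R u))) (at r within {0..s})"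
      by (rule has_derivative_compose[where f = "\<lambda>r. x + r *\<^sub>R u + s *\<^sub>R v", OF _ f[OF 1(1)]])(auto intro!: derivative_eq_intros)
    moreover have "((\<lambda>r. f (x + r *\<^sub>R u)) has_derivative
            (\<lambda>h. blinfun_apply (f' (x + r *\<^sub>R u)) (h *\<^sub>R u))) (at r within {0..s})"
      by (rule has_derivative_compose[where f = "\<lambda>r. x + r *\<^sub>R u", OF _ f[OF 1(2)]])(auto intro!: derivative_eq_intros)
    ultimately show ?thesis
      unfolding g_def g'_def
      by (auto intro!: derivative_eq_intros simp: blinfun.bilinear_simps scaleR_diff_right)
  qed
  have bound: "norm (g' r u - s *\<^sub>R F v u) \<le> 2 * e * s * N * norm u" if r: "r \<in> {0..s}" for r
  proof -
    have 1: "norm (r *\<^sub>R u + s *\<^sub>R v) \<le> s * N" "norm (r *\<^sub>R u + 0 *\<^sub>R v) \<le> s * N"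
      using near r pos by blast+
    have 2: "norm (f' (x + r *\<^sub>R u + s *\<^sub>R v) - f' x - F (r *\<^sub>R u + s *\<^sub>R v)) \<le> e * (s * N)"
      using f'[of "x + r *\<^sub>R u + s *\<^sub>R v"] 1 s(2) e
      mult_left_mono[OF 1(1) e] by (auto simp: N_def add.assoc)
    have 3: "norm (f' (x + r *\<^sub>R u) - f' x - F (r *\<^sub>R u)) \<le> e * (s * N)"
      using f'[of "x + r *\<^sub>R u"] 1 s(2) e
      mult_left_mono[OF 1(2) e] by (auto simp: N_def add.assoc)
    have eq: "g' r - s *\<^sub>R F v = (f' (x + r *\<^sub>R u + s *\<^sub>R v) - f' x - F (r *\<^sub>R u + s *\<^sub>R v))
        - (f' (x + r *\<^sub>R u) - f' x - F (r *\<^sub>R u))"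
      by (simp add: g'_def linear_add[OF F] linear_scale[OF F])
    have "norm (g' r - s *\<^sub>R F v) \<le> 2 * e * s * N"
      unfolding eq by (rule norm_triangle_ineq4[THEN order_trans]) (use 2 3 in simp)
    then have "norm ((g' r - s *\<^sub>R F v) u) \<le> 2 * e * s * N * norm u"
      by (meson norm_blinfun order_trans mult_right_mono norm_ge_zero)
    then show ?thesis by (simp add: blinfun.bilinear_simps)
  qed
  \<comment> \<open>Subtracting the expected linear growth makes the derivative of \<open>k\<close>
    the small quantity in \<open>bound\<close>, so the mean value inequality yields the
    claim.\<close>
  define k where "k r = g r - r *\<^sub>R (s *\<^sub>R F v u)" for r
  have "norm (k s - k 0) \<le> (2 * e * s * N * norm u) * norm (s - 0)"
  proof (rule differentiable_bound[of "{0..s}" k "\<lambda>r h. h *\<^sub>R (g' r u - s *\<^sub>R F v u)"])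
    show "(k has_derivative (\<lambda>h. h *\<^sub>R (g' r u - s *\<^sub>R F v u))) (at r within {0..s})" if "r \<in> {0..s}" for r
      unfolding k_def by (auto intro!: derivative_eq_intros der[OF that] simp: scaleR_diff_right)
    show "onorm (\<lambda>h. h *\<^sub>R (g' r u - s *\<^sub>R F v u)) \<le> 2 * e * s * N * norm u" if "r \<in> {0..s}" for r
      using bound[OF that] by (auto intro!: onorm_le simp: mult.commute mult_left_mono)
  qed (use pos in auto)
  moreover have "k s - k 0 = f (x + s *\<^sub>R u + s *\<^sub>R v) - f (x + s *\<^sub>R u) - f (x + s *\<^sub>R v) + f x
           - s\<^sup>2 *\<^sub>R F v u"
    by (simp add: k_def g_def power2_eq_square)
  ultimately show ?thesis using s by (simp add: N_def power2_eq_square mult_ac)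
qed

text \<open>The second difference \<open>D\<close> does not change when \<open>u\<close> and
  \<open>v\<close> are interchanged, and it is close to both
  \<open>s\<^sup>2 *\<^sub>R F v u\<close> and \<open>s\<^sup>2 *\<^sub>R F u v\<close>, with an
  error that is an arbitrarily small multiple of \<open>s\<^sup>2\<close>.\<close>

lemma symmetric_second_derivative:
  fixes f :: "'a::real_normed_vector \<Rightarrow> 'b::real_normed_vector" and f' :: "'a \<Rightarrow> 'a \<Rightarrow>\<^sub>L 'b"
  assumes "open S" "x \<in> S"
    and f: "\<And>w. w \<in> S \<Longrightarrow> (f has_derivative blinfun_apply (f' w)) (at w)"
    and f': "(f' has_derivative F) (at x)"
  shows "F u v = F v u"
proof -
  have lin: "linear F" using f' by (rule has_derivative_linear)
  define C where "C = 2 * (norm u + norm v) * norm u + 2 * (norm v + norm u) * norm v"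
  have "norm (F v u - F u v) \<le> e * C" if e: "0 < e" for e
  proof -
    obtain d1 where d1: "0 < d1" "\<And>w. norm (w - x) < d1 \<Longrightarrow> w \<in> S"
      using assms(1,2) by (metis dist_commute dist_norm open_contains_ball mem_ball subsetD)
    obtain d2 where d2: "0 < d2"
      "\<And>w. norm (w - x) < d2 \<Longrightarrow> norm (f' w - f' x - F (w - x)) \<le> e * norm (w - x)"
      using f' e unfolding has_derivative_at_alt by metis
    define d where "d = min d1 d2"
    define s where "s = d / (norm u + norm v + 1) / 2"
    have "d > 0" using d1 d2 by (simp add: d_def)
    have "norm u + norm v \<ge> 0" by simp
    have s: "0 < s" "s * (norm u + norm v) < d" "s * (norm v + norm u) < d"
      using \<open>d > 0\<close> \<open>norm u + norm v \<ge> 0\<close> unfolding s_def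
      by (auto simp: field_simps add_pos_nonneg intro!: add_pos_pos mult_pos_pos add_nonneg_pos)
    define D where "D = f (x + s *\<^sub>R u + s *\<^sub>R v) - f (x + s *\<^sub>R u) - f (x + s *\<^sub>R v) + f x"
    have D2: "D = f (x + s *\<^sub>R v + s *\<^sub>R u) - f (x + s *\<^sub>R v) - f (x + s *\<^sub>R u) + f x"
      by (simp add: D_def algebra_simps)
    have "norm (D - s\<^sup>2 *\<^sub>R F v u) \<le> 2 * e * (norm u + norm v) * norm u * s\<^sup>2"
      unfolding D_def
      by (rule second_difference_bound[where d = d and f' = f']) (use d1 d2 f lin s e in \<open>auto simp: d_def\<close>)
    moreover have "norm (D - s\<^sup>2 *\<^sub>R F u v) \<le> 2 * e * (norm v + norm u) * norm v * s\<^sup>2"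
      unfolding D2
      by (rule second_difference_bound[where d = d and f' = f']) (use d1 d2 f lin s e in \<open>auto simp: d_def\<close>)
    ultimately have "norm (s\<^sup>2 *\<^sub>R F v u - s\<^sup>2 *\<^sub>R F u v) \<le> s\<^sup>2 * (e * C)"
      unfolding C_def
      using norm_triangle_ineq4[of "D - s\<^sup>2 *\<^sub>R F u v" "D - s\<^sup>2 *\<^sub>R F v u"]
      by (simp add: algebra_simps)
    then show ?thesis using s(1) by (simp flip: scaleR_diff_right)
  qed
  moreover have "\<exists>e>0. e * C < r" if "0 < r" for r
  proof -
    have "C \<ge> 0" by (simp add: C_def)
    then have "r / (C + 1) * C < r" "r / (C + 1) > 0" using that by (auto simp: field_simps)
    then show ?thesis by blast
  qed
  ultimately have "\<not> 0 < norm (F v u - F u v)" by (metis not_less)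
  then show ?thesis by simp
qed

text \<open>Poincare lemma by integration along radii: symmetry turns the derivative of
  \<open>L (t *\<^sub>R x) x\<close> with respect to \<open>x\<close> into \<open>fx x t\<close>,
  which is also the derivative of \<open>t *\<^sub>R L (t *\<^sub>R x)\<close> with respect to
  \<open>t\<close>. The fundamental theorem of calculus then leaves the boundary value
  \<open>L z\<close>.\<close>

lemma poincare_ball:
  fixes L :: "'a::banach \<Rightarrow> 'a \<Rightarrow>\<^sub>L 'b::banach" and L' :: "'a \<Rightarrow> 'a \<Rightarrow>\<^sub>L 'a \<Rightarrow>\<^sub>L 'b"
  assumes L: "\<And>z. z \<in> ball 0 1 \<Longrightarrow> (L has_derivative blinfun_apply (L' z)) (at z)"
    and cont: "continuous_on (ball 0 1) L'"
    and sym: "\<And>z u v. z \<in> ball 0 1 \<Longrightarrow> L' z u v = L' z v u"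
    and z: "z \<in> ball 0 1"
  shows "((\<lambda>z. integral {0..1} (\<lambda>t::real. L (t *\<^sub>R z) z)) has_derivative blinfun_apply (L z)) (at z)"
proof -
  have scal: "t *\<^sub>R x \<in> ball 0 1" if "x \<in> ball 0 1" "t \<in> {0..1}" for x :: 'a and t :: real
  proof -
    have "\<bar>t\<bar> * norm x \<le> 1 * norm x" using that by (intro mult_right_mono) auto
    then show ?thesis using that by auto
  qed
  have contL: "continuous_on (ball 0 1) L"
    using L by (meson continuous_at_imp_continuous_on has_derivative_continuous)
  define fx where "fx x t = t *\<^sub>R L' (t *\<^sub>R x) x + L (t *\<^sub>R x)" for x t
  have "((\<lambda>z. integral (cbox 0 1) (\<lambda>t::real. L (t *\<^sub>R z) z)) has_derivative integral (cbox 0 1) (fx z))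
          (at z within ball 0 1)"
  proof (rule leibniz_rule)
    show "((\<lambda>x. L (t *\<^sub>R x) x) has_derivative blinfun_apply (fx x t)) (at x within ball 0 1)"
      if "x \<in> ball 0 1" "t \<in> cbox 0 1" for x t
    proof -
      have m: "t *\<^sub>R x \<in> ball 0 1" using scal that by simp
      have 1: "((\<lambda>x. L (t *\<^sub>R x)) has_derivative (\<lambda>v. L' (t *\<^sub>R x) (t *\<^sub>R v))) (at x within ball 0 1)"
        by (rule has_derivative_compose[where f = "\<lambda>x. t *\<^sub>R x", OF _ L[OF m]]) (auto intro!: derivative_eq_intros)
      show ?thesis
        by (rule has_derivative_eq_rhs[OF blinfun.FDERIV[OF 1 has_derivative_ident]])
           (auto simp: fx_def fun_eq_iff blinfun.bilinear_simps sym[OF m])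
    qed
    show "(\<lambda>t. L (t *\<^sub>R x) x) integrable_on cbox (0::real) 1" if "x \<in> ball 0 1" for x
      using scal that
      by (intro integrable_continuous continuous_intros continuous_on_compose2[OF contL]) auto
    have m: "(\<lambda>p. snd p *\<^sub>R fst p) ` (ball 0 1 \<times> cbox (0::real) 1) \<subseteq> ball (0::'a) 1"
      using scal by fastforce
    show "continuous_on (ball 0 1 \<times> cbox 0 1) (\<lambda>(x, t). fx x t)"
      unfolding fx_def split_beta
      by (intro continuous_intros continuous_on_compose2[OF contL _ m] continuous_on_compose2[OF cont _ m])
  qed (use z in auto)
  moreover have "(fx z has_integral (1 *\<^sub>R L (1 *\<^sub>R z) - 0 *\<^sub>R L (0 *\<^sub>R z))) {0..1}"
  proof (rule fundamental_theorem_of_calculus)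
    show "((\<lambda>t. t *\<^sub>R L (t *\<^sub>R z)) has_vector_derivative fx z t) (at t within {0..1})" if "t \<in> {0..1}" for t
    proof -
      have m: "t *\<^sub>R z \<in> ball 0 1" using scal that z by simp
      have 1: "((\<lambda>t. L (t *\<^sub>R z)) has_derivative (\<lambda>h. L' (t *\<^sub>R z) (h *\<^sub>R z))) (at t within {0..1})"
        by (rule has_derivative_compose[where f = "\<lambda>t. t *\<^sub>R z", OF _ L[OF m]]) (auto intro!: derivative_eq_intros)
      show ?thesis
        unfolding has_vector_derivative_def
        by (rule has_derivative_eq_rhs[OF has_derivative_scaleR[OF has_derivative_ident 1]])
           (auto simp: fx_def fun_eq_iff blinfun.bilinear_simps algebra_simps)
    qed
  qed simp
  ultimately show ?thesis
    using z by (simp add: integral_unique at_within_open[of z "ball 0 1"])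
qed

section \<open>Wirtinger derivatives, complex linearity and the canonical decomposition\<close>

lemma dir_deriv_eq:
  assumes "(u has_derivative U) (at z)"
  shows "dir_deriv v u z = U v"
proof -
  interpret U: bounded_linear U using assms by (rule has_derivative_bounded_linear)
  have "((\<lambda>t. u (z + t *\<^sub>R v)) has_derivative (\<lambda>t. U (t *\<^sub>R v))) (at 0)"
    by (rule has_derivative_compose[where f = "\<lambda>t. z + t *\<^sub>R v"])
       (use assms in \<open>auto intro!: derivative_eq_intros\<close>)
  then have "((\<lambda>t. u (z + t *\<^sub>R v)) has_vector_derivative U v) (at 0)"
    by (simp add: has_vector_derivative_def U.scaleR)
  then show ?thesis unfolding dir_deriv_def by (rule vector_derivative_at)
qed

lemma bounded_linear_vec_scale: "bounded_linear (\<lambda>v :: complex ^ 'n. c *s v)"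
  by (subst linear_conv_bounded_linear[symmetric])
     (auto intro!: linearI simp: vec_eq_iff algebra_simps scaleR_conv_of_real)

text \<open>A \<open>blinfun\<close>, so that it can be composed with derivatives; complex linearity
  of a real derivative becomes commutation with \<open>mul_i\<close>.\<close>

definition mul_i :: "(complex ^ 'n) \<Rightarrow>\<^sub>L (complex ^ 'n)" where
  "mul_i = Blinfun (\<lambda>v. \<i> *s v)"

lemma mul_i_apply: "mul_i v = \<i> *s v"
  by (simp add: mul_i_def bounded_linear_Blinfun_apply[OF bounded_linear_vec_scale])

lemma mul_i_mul_i: "mul_i (mul_i v) = - v"
  by (simp add: mul_i_apply vec_eq_iff)

lemma linear_zero_on_axes:
  fixes F :: "complex ^ 'n \<Rightarrow> 'b::real_vector"
  assumes "linear F" and "\<And>i. F (axis i 1) = 0" and "\<And>i. F (axis i \<i>) = 0"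
  shows "F v = 0"
proof -
  have "F = (\<lambda>_. 0)"
    by (rule linear_eq_stdbasis[OF assms(1) linear_zero])
       (use assms(2,3) in \<open>auto simp: Basis_vec_def Basis_complex_def\<close>)
  then show ?thesis by simp
qed

lemma axis_i: "axis j \<i> = mul_i (axis j 1)"
  by (simp add: mul_i_apply vec_eq_iff axis_def)

text \<open>The form \<open>T\<close> below is the (1,1)-part of the Hessian, linear in \<open>u\<close> and conjugate linear in \<open>v\<close>. It
  vanishes by pluriharmonicity; as the Hessian is symmetric, the claim is the antisymmetric part of
  \<open>T = 0\<close>.\<close>

lemma second_derivative_mul_i:
  fixes f :: "complex ^ 'n \<Rightarrow> complex ^ 'n"
  assumes f: "\<And>w. w \<in> ball 0 1 \<Longrightarrow> (f has_derivative blinfun_apply (f' w)) (at w)"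
    and f': "\<And>w. w \<in> ball 0 1 \<Longrightarrow> (f' has_derivative blinfun_apply (f'' w)) (at w)"
    and ph: "\<And>i j k w. w \<in> ball 0 1 \<Longrightarrow> wirtinger i (wirtinger_bar j (\<lambda>w. f w $ k)) w = 0"
    and z: "z \<in> ball 0 1"
  shows "f'' z u (mul_i v) = f'' z (mul_i u) v"
proof -
  define T where "T u v = f'' z u v + mul_i (f'' z u (mul_i v)) - mul_i (f'' z (mul_i u) v)
                            + f'' z (mul_i u) (mul_i v)" for u v
  have T_axis: "T (axis i 1) (axis j 1) = 0" for i j
  proof -
    have "T (axis i 1) (axis j 1) $ k = 4 * wirtinger i (wirtinger_bar j (\<lambda>w. f w $ k)) z" for k
    proof -
      have bar: "wirtinger_bar j (\<lambda>w. f w $ k) w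
          = (f' w (axis j 1) $ k + \<i> * f' w (axis j \<i>) $ k) / 2" if w: "w \<in> ball 0 1" for w
      proof -
        have "((\<lambda>w. f w $ k) has_derivative (\<lambda>v. f' w v $ k)) (at w)"
          using f[OF w] by (rule bounded_linear.has_derivative[OF bounded_linear_vec_nth])
        then show ?thesis unfolding wirtinger_bar_def by (simp add: dir_deriv_eq)
      qed
      have app: "((\<lambda>w. f' w a $ k) has_derivative (\<lambda>v. f'' z v a $ k)) (at z)" for a
        by (intro bounded_linear.has_derivative[OF bounded_linear_vec_nth]
             bounded_linear.has_derivative[OF blinfun.bounded_linear_left f'[OF z]])
      have "((\<lambda>w. (f' w (axis j 1) $ k + \<i> * f' w (axis j \<i>) $ k) / 2) has_derivative
              (\<lambda>v. (f'' z v (axis j 1) $ k + \<i> * f'' z v (axis j \<i>) $ k) / 2)) (at z)"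
        by (auto intro!: derivative_eq_intros app)
      then have "((\<lambda>w. wirtinger_bar j (\<lambda>w. f w $ k) w) has_derivative
              (\<lambda>v. (f'' z v (axis j 1) $ k + \<i> * f'' z v (axis j \<i>) $ k) / 2)) (at z)"
        by (rule has_derivative_transform_within_open[OF _ open_ball z]) (simp add: bar)
      note D = dir_deriv_eq[OF this]
      show ?thesis
        unfolding wirtinger_def[of i] D T_def axis_i
        by (simp add: mul_i_apply[of "blinfun_apply _ _"] algebra_simps diff_divide_distrib add_divide_distrib)
    qed
    then show ?thesis using ph[OF z] by (simp add: vec_eq_iff)
  qed
  have T_i: "T (mul_i u) v = mul_i (T u v)" "T u (mul_i v) = - mul_i (T u v)" for u v
    by (simp_all add: T_def mul_i_mul_i blinfun.bilinear_simps)
  have lin: "linear (\<lambda>v. T u v)" "linear (\<lambda>u. T u v)" for u v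
    by (auto intro!: linearI simp: T_def blinfun.bilinear_simps algebra_simps)
  \<comment> \<open>\<open>T_axis\<close> covers only the directions \<open>axis i 1\<close>; since
    \<open>axis i \<i>\<close> is \<open>mul_i (axis i 1)\<close>, the rules \<open>T_i\<close>
    reduce the remaining real basis vectors to these.\<close>
  have T1: "T (axis i 1) v = 0" for i v
    by (rule linear_zero_on_axes[OF lin(1)]) (simp_all add: T_axis axis_i T_i blinfun.bilinear_simps)
  have T0: "T u v = 0" for u v
    by (rule linear_zero_on_axes[OF lin(2)]) (simp_all add: T1 axis_i T_i blinfun.bilinear_simps)
  have sym: "f'' z u v = f'' z v u" for u v
    by (rule symmetric_second_derivative[OF open_ball z f f'[OF z]])
  have eq: "mul_i (f'' z u (mul_i v)) - mul_i (f'' z (mul_i u) v) = (1/2) *\<^sub>R (T u v - T v u)"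
    by (simp add: T_def sym[of v u] sym[of v "mul_i u"] sym[of "mul_i v" u] sym[of "mul_i v" "mul_i u"]
          algebra_simps flip: scaleR_add_left)
  have "mul_i (f'' z u (mul_i v)) = mul_i (f'' z (mul_i u) v)" using eq by (simp add: T0)
  then have "mul_i (mul_i (f'' z u (mul_i v))) = mul_i (mul_i (f'' z (mul_i u) v))" by simp
  then show ?thesis by (simp add: mul_i_mul_i)
qed

text \<open>Splitting \<open>c\<close> into real and imaginary part upgrades real linearity to
  complex linearity; the matrix is the form of derivative that \<open>holomorphic_map_on\<close>
  asks for.\<close>

lemma linear_commuting_mul_i:
  fixes F :: "(complex ^ 'n) \<Rightarrow>\<^sub>L (complex ^ 'n)"
  assumes "\<And>v. F (mul_i v) = mul_i (F v)"
  obtains A :: "complex ^ 'n ^ 'n" where "blinfun_apply F = (\<lambda>v. A *v v)"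
proof -
  have F: "F (c *s v) = c *s F v" for c v
  proof -
    have "c *s v = Re c *\<^sub>R v + Im c *\<^sub>R mul_i v" for v :: "complex ^ 'n"
      by (simp add: vec_eq_iff mul_i_apply complex_eq_iff)
    then show ?thesis by (simp add: blinfun.bilinear_simps assms)
  qed
  have "Vector_Spaces.linear (*s) (*s) (blinfun_apply F)"
    by (auto simp: Vector_Spaces.linear_iff F blinfun.bilinear_simps vec.vector_space_axioms)
  then have "blinfun_apply F = (\<lambda>v. matrix F *v v)" by (simp add: fun_eq_iff matrix_works)
  then show ?thesis by (rule that)
qed

lemma cnj_vec_bounded_linear: "bounded_linear (cnj_vec :: complex ^ 'n \<Rightarrow> complex ^ 'n)"
  by (subst linear_conv_bounded_linear[symmetric])
     (auto intro!: linearI simp: cnj_vec_def vec_eq_iff)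

text \<open>The form \<open>L\<close>, the complex linear part of \<open>f'\<close>, is closed by
  \<open>second_derivative_mul_i\<close> together with the symmetry of \<open>f''\<close>. Its
  primitive \<open>h\<close> is therefore holomorphic, and \<open>f - h\<close> has a conjugate
  linear derivative, so its conjugate is holomorphic as well.\<close>

lemma canonical_decomposition_exists:
  assumes "f \<in> pluriharmonic_maps"
  shows "\<exists>p. canonical_decomposition f p"
proof -
  from assms obtain f' f'' where
    f: "\<And>w. w \<in> ball 0 1 \<Longrightarrow> (f has_derivative blinfun_apply (f' w)) (at w)"
    and f': "\<And>w. w \<in> ball 0 1 \<Longrightarrow> (f' has_derivative blinfun_apply (f'' w)) (at w)"
    and cont: "continuous_on (ball 0 1) f''"
    and ph: "\<And>i j k w. w \<in> ball 0 1 \<Longrightarrow> wirtinger i (wirtinger_bar j (\<lambda>w. f w $ k)) w = 0"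
    unfolding pluriharmonic_maps_def C2_on_def by blast
  \<comment> \<open>\<open>P\<close> projects a real linear map onto its complex linear part.\<close>
  define P where "P a = (1/2) *\<^sub>R (a - (mul_i o\<^sub>L (a o\<^sub>L mul_i)))" for a :: "(complex ^ 'a) \<Rightarrow>\<^sub>L (complex ^ 'a)"
  have K: "bounded_linear (\<lambda>a :: (complex ^ 'a) \<Rightarrow>\<^sub>L (complex ^ 'a). mul_i o\<^sub>L (a o\<^sub>L mul_i))"
    by (rule bounded_linear_compose[OF bounded_bilinear.bounded_linear_right[OF bounded_bilinear_blinfun_compose]
            bounded_bilinear.bounded_linear_left[OF bounded_bilinear_blinfun_compose]])
  have P: "bounded_linear P"
    unfolding P_def
    by (rule bounded_linear_compose[OF bounded_linear_scaleR_right bounded_linear_sub[OF bounded_linear_ident K]])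
  define L where "L w = P (f' w)" for w
  define L' where "L' w = Blinfun P o\<^sub>L f'' w" for w
  have P_apply: "P a v = (1/2) *\<^sub>R (a v - mul_i (a (mul_i v)))" for a v
    by (simp add: P_def blinfun.bilinear_simps)
  define h where "h z = integral {0..1} (\<lambda>t::real. L (t *\<^sub>R z) z)" for z
  have h: "(h has_derivative blinfun_apply (L z)) (at z)" if z: "z \<in> ball 0 1" for z
    unfolding h_def
  proof (rule poincare_ball[OF _ _ _ z])
    show "(L has_derivative blinfun_apply (L' w)) (at w)" if "w \<in> ball 0 1" for w
    proof -
      have "blinfun_apply (L' w) = (\<lambda>v. P (f'' w v))"
        by (simp add: fun_eq_iff L'_def bounded_linear_Blinfun_apply[OF P])
      then show ?thesis
        using bounded_linear.has_derivative[OF P f'[OF that]] by (simp add: L_def[abs_def])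
    qed
    show "continuous_on (ball 0 1) L'"
      unfolding L'_def by (intro continuous_intros cont)
    show "L' w u v = L' w v u" if w: "w \<in> ball 0 1" for w u v
      using second_derivative_mul_i[OF f f' ph w, of u v]
        symmetric_second_derivative[OF open_ball w f f'[OF w]]
      by (simp add: L'_def bounded_linear_Blinfun_apply[OF P] P_apply)
  qed
  \<comment> \<open>As \<open>h 0 = 0\<close>, the constant \<open>f 0\<close> makes the second
    component vanish at the origin, which is the normalisation of the decomposition.\<close>
  have "holomorphic_map_on (\<lambda>z. h z + f 0) (ball 0 1)"
    unfolding holomorphic_map_on_def
  proof
    fix z :: "complex ^ 'a" assume z: "z \<in> ball 0 1"
    obtain A where "blinfun_apply (L z) = (\<lambda>v. A *v v)"
      by (rule linear_commuting_mul_i[of "L z"])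
         (simp add: L_def P_apply mul_i_mul_i blinfun.bilinear_simps algebra_simps)
    with h[OF z] have "((\<lambda>z. h z + f 0) has_derivative (\<lambda>v. A *v v)) (at z)"
      by (auto intro!: derivative_eq_intros)
    then show "\<exists>A. ((\<lambda>z. h z + f 0) has_derivative (\<lambda>v. A *v v)) (at z)" by blast
  qed
  moreover have "holomorphic_map_on (\<lambda>z. cnj_vec (f z - (h z + f 0))) (ball 0 1)"
    unfolding holomorphic_map_on_def
  proof
    fix z :: "complex ^ 'a" assume z: "z \<in> ball 0 1"
    define G where "G = Blinfun cnj_vec o\<^sub>L (f' z - L z)"
    have G: "G v = cnj_vec (f' z v - L z v)" for v
      by (simp add: G_def bounded_linear_Blinfun_apply[OF cnj_vec_bounded_linear] blinfun.bilinear_simps)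
    obtain A where A: "blinfun_apply G = (\<lambda>v. A *v v)"
    proof (rule linear_commuting_mul_i[of G])
      have cm: "cnj_vec (mul_i x) = - mul_i (cnj_vec x)" for x :: "complex ^ 'a"
        by (simp add: cnj_vec_def mul_i_apply vec_eq_iff)
      \<comment> \<open>The complement of the projection \<open>P\<close>: the conjugate linear
        part, which anticommutes with \<open>mul_i\<close>. So does \<open>cnj_vec\<close>, and the
        two signs cancel in \<open>G\<close>.\<close>
      have anti: "f' z v - L z v = (1/2) *\<^sub>R (f' z v + mul_i (f' z (mul_i v)))" for v
        by (simp add: L_def P_apply algebra_simps flip: scaleR_add_left)
      have "f' z (mul_i v) - L z (mul_i v) = - mul_i (f' z v - L z v)" for v
        unfolding anti by (simp add: mul_i_mul_i blinfun.bilinear_simps scaleR_add_right scaleR_diff_right)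
      then show "G (mul_i v) = mul_i (G v)" for v
        unfolding G using cm[of "f' z v - L z v"]
          linear_neg[OF bounded_linear.linear[OF cnj_vec_bounded_linear]] by (metis add.inverse_inverse)
    qed
    have "((\<lambda>z. f z - (h z + f 0)) has_derivative (\<lambda>v. f' z v - L z v)) (at z)"
      using h[OF z] f[OF z] by (auto intro!: derivative_eq_intros)
    from bounded_linear.has_derivative[OF cnj_vec_bounded_linear this]
    have "((\<lambda>z. cnj_vec (f z - (h z + f 0))) has_derivative (\<lambda>v. A *v v)) (at z)"
      using G A by (simp add: fun_eq_iff)
    then show "\<exists>A. ((\<lambda>z. cnj_vec (f z - (h z + f 0))) has_derivative (\<lambda>v. A *v v)) (at z)" by blast
  qed
  ultimately have "canonical_decomposition f (\<lambda>z. h z + f 0, \<lambda>z. cnj_vec (f z - (h z + f 0)))"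
    unfolding canonical_decomposition_def by (auto simp: cnj_vec_def vec_eq_iff h_def)
  then show ?thesis by blast
qed

section \<open>The Bergman distance\<close>

lemma hinner_simps:
  "hinner (x + y) z = hinner x z + hinner y z" "hinner z (x + y) = hinner z x + hinner z y"
  "hinner (x - y) z = hinner x z - hinner y z" "hinner z (x - y) = hinner z x - hinner z y"
  "hinner (c *s x) z = c * hinner x z" "hinner z (c *s x) = cnj c * hinner z x"
  "hinner (r *\<^sub>R x) z = of_real r * hinner x z" "hinner z (r *\<^sub>R x) = of_real r * hinner z x"
  "hinner 0 z = 0" "hinner z 0 = 0"
  by (simp_all add: hinner_def sum.distrib sum_subtractf sum_distrib_left algebra_simps scaleR_conv_of_real[where 'a=complex])

lemma hinner_commute: "hinner w z = cnj (hinner z w)"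
  by (simp add: hinner_def mult.commute)

lemma hinner_self: "hinner z z = of_real ((norm z)\<^sup>2)"
  by (simp add: hinner_def norm_vec_def L2_set_def sum_nonneg complex_mult_cnj cmod_power2)

lemma Re_hinner: "Re (hinner z w) = z \<bullet> w"
  by (simp add: hinner_def inner_vec_def inner_complex_def)

text \<open>The real inner product sees only real parts, so \<open>z\<close> is first rotated by a
  unimodular \<open>c\<close> that makes the Hermitian product real and nonnegative.\<close>

lemma norm_hinner_le: "cmod (hinner z w) \<le> norm z * norm w"
proof -
  define c where "c = (if hinner z w = 0 then 1 else cnj (sgn (hinner z w)))"
  have c: "cmod c = 1" by (simp add: c_def norm_sgn)
  have n: "norm (c *s z) = norm z"
    by (simp add: norm_vec_def L2_set_def norm_mult c)
  have "c * hinner z w = of_real (cmod (hinner z w))"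
    by (simp add: c_def sgn_div_norm scaleR_conv_of_real field_simps complex_norm_square[symmetric] power2_eq_square)
  then have "cmod (hinner z w) = Re (hinner (c *s z) w)" by (simp add: hinner_simps)
  also have "\<dots> \<le> norm z * norm w" unfolding Re_hinner using n norm_cauchy_schwarz by metis
  finally show ?thesis .
qed

lemma bounded_linear_hinner_left: "bounded_linear (\<lambda>x. hinner x z)"
  by (subst linear_conv_bounded_linear[symmetric]) (auto intro!: linearI simp: hinner_simps scaleR_conv_of_real[where 'a=complex])

lemma norm_less_1_square: "0 < 1 - (norm z)\<^sup>2" if "z \<in> ball 0 1"
  using that by (simp add: abs_square_less_1)

lemma hinner_ne_1: "hinner z w \<noteq> 1" if "z \<in> ball 0 1" "w \<in> ball 0 1"
proof
  assume "hinner z w = 1"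
  with norm_hinner_le[of z w] have "1 \<le> norm z * norm w" by simp
  moreover have "norm z * norm w < 1 * 1" using that by (intro mult_strict_mono') auto
  ultimately show False by simp
qed

section \<open>The Bergman norm and the growth of the invariant distance\<close>

definition bergman_norm :: "complex ^ 'n \<Rightarrow> complex ^ 'n \<Rightarrow> real" where
  "bergman_norm w v = sqrt (Re (hinner (bergman_matrix w *v v) v))"

lemma bergman_norm_eq:
  "bergman_norm w v = sqrt (((1 - (norm w)\<^sup>2) * (norm v)\<^sup>2 + (cmod (hinner v w))\<^sup>2) / (1 - (norm w)\<^sup>2)\<^sup>2)"
proof -
  define s where "s = 1 - (norm w)\<^sup>2"
  have "(bergman_matrix w *v v) $ i = (of_real s * v $ i + w $ i * hinner v w) / of_real (s\<^sup>2)" for i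
  proof -
    have "(bergman_matrix w *v v) $ i
        = (\<Sum>j\<in>UNIV. of_real s * (if i = j then v $ j else 0) / of_real (s\<^sup>2)
             + w $ i * (v $ j * cnj (w $ j)) / of_real (s\<^sup>2))"
      unfolding matrix_vector_mult_def bergman_matrix_def s_def[symmetric]
      by (auto simp: mat_def algebra_simps add_divide_distrib intro!: sum.cong)
    also have "\<dots> = of_real s * v $ i / of_real (s\<^sup>2) + w $ i * hinner v w / of_real (s\<^sup>2)"
      by (simp add: sum.distrib hinner_def sum_distrib_left[symmetric] sum_divide_distrib[symmetric])
    finally show ?thesis by (simp add: add_divide_distrib)
  qed
  then have "hinner (bergman_matrix w *v v) v
      = (\<Sum>i\<in>UNIV. (of_real s * (v $ i * cnj (v $ i)) + hinner v w * (w $ i * cnj (v $ i))) / of_real (s\<^sup>2))"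
    unfolding hinner_def[of _ v] by (intro sum.cong) (auto simp: algebra_simps)
  also have "\<dots> = (of_real s * hinner v v + hinner v w * hinner w v) / of_real (s\<^sup>2)"
    by (simp add: sum.distrib hinner_def sum_distrib_left[symmetric] sum_divide_distrib[symmetric])
  also have "\<dots> = of_real ((s * (norm v)\<^sup>2 + (cmod (hinner v w))\<^sup>2) / s\<^sup>2)"
    by (simp add: hinner_self hinner_commute[of w v] flip: complex_norm_square)
  finally show ?thesis by (simp add: bergman_norm_def s_def)
qed

text \<open>Since \<open>1 - \<bar>\<phi>\<^sub>z(w)\<bar>\<^sup>2 = (1 - \<bar>z\<bar>\<^sup>2)(1 - \<bar>w\<bar>\<^sup>2) / \<bar>1 - \<langle>w,z\<rangle>\<bar>\<^sup>2\<close>, this is \<open>cosh\<close> of the Bergman distance.\<close>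

definition bergman_cosh :: "complex ^ 'n \<Rightarrow> complex ^ 'n \<Rightarrow> real" where
  "bergman_cosh z w = cmod (1 - hinner w z) / sqrt ((1 - (norm z)\<^sup>2) * (1 - (norm w)\<^sup>2))"

text \<open>Divided by \<open>(1 - (norm z)\<^sup>2) * (1 - (norm w)\<^sup>2)\<close>, the left-hand
  side is \<open>(bergman_cosh z w)\<^sup>2 - 1\<close>, the squared sinh of the distance; the
  right-hand side is, up to a positive factor, the squared Bergman norm at \<open>w\<close> of the
  vector \<open>w - z\<close>.\<close>

lemma bergman_identity:
  "(cmod (1 - hinner w z))\<^sup>2 - (1 - (norm z)\<^sup>2) * (1 - (norm w)\<^sup>2)
     = (1 - (norm w)\<^sup>2) * (norm (w - z))\<^sup>2 + (cmod (hinner w (w - z)))\<^sup>2"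
proof -
  have 1: "(norm (w - z))\<^sup>2 = (norm w)\<^sup>2 - 2 * Re (hinner w z) + (norm z)\<^sup>2"
    unfolding Re_hinner by (simp add: power2_norm_eq_inner inner_commute algebra_simps)
  have 2: "hinner w (w - z) = of_real ((norm w)\<^sup>2) - hinner w z"
    by (simp add: hinner_simps hinner_self)
  show ?thesis unfolding 1 2 cmod_power2 by (simp add: power2_eq_square algebra_simps)
qed

lemma bergman_cosh_ge_1:
  assumes "z \<in> ball 0 1" "w \<in> ball 0 1"
  shows "1 \<le> bergman_cosh z w"
proof -
  have "0 \<le> (1 - (norm w)\<^sup>2) * (norm (w - z))\<^sup>2 + (cmod (hinner w (w - z)))\<^sup>2"
    using norm_less_1_square[OF assms(2)] by auto
  then have "(1 - (norm z)\<^sup>2) * (1 - (norm w)\<^sup>2) \<le> (cmod (1 - hinner w z))\<^sup>2"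
    using bergman_identity[of w z] by linarith
  then have "sqrt ((1 - (norm z)\<^sup>2) * (1 - (norm w)\<^sup>2)) \<le> cmod (1 - hinner w z)"
    by (intro real_le_lsqrt) auto
  then show ?thesis
    unfolding bergman_cosh_def
    using mult_pos_pos[OF norm_less_1_square[OF assms(1)] norm_less_1_square[OF assms(2)]]
    by (subst le_divide_eq_1_pos) simp_all
qed

text \<open>Cauchy--Schwarz for the form \<open>s\<langle>v,y\<rangle> + \<langle>v,w\<rangle>\<langle>w,y\<rangle>\<close>, which is the Bergman metric at \<open>w\<close> up to
  the factor \<open>s\<^sup>2\<close>, applied to \<open>y = w - z\<close>.\<close>

lemma bergman_cauchy_schwarz:
  assumes "w \<in> ball 0 1"
  defines "s \<equiv> 1 - (norm w)\<^sup>2"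
  shows "(cmod ((1 - hinner w z) * hinner v w - of_real s * hinner v z))\<^sup>2
    \<le> (s * (norm v)\<^sup>2 + (cmod (hinner v w))\<^sup>2)
      * ((cmod (1 - hinner w z))\<^sup>2 - (1 - (norm z)\<^sup>2) * s)"
proof -
  define y where "y = w - z"
  have s: "0 < s" using assms norm_less_1_square by simp
  have eq: "(1 - hinner w z) * hinner v w - of_real s * hinner v z
      = of_real s * hinner v y + hinner v w * hinner w y"
    by (simp add: y_def s_def hinner_simps hinner_self algebra_simps)
  have "cmod \<dots> \<le> s * cmod (hinner v y) + cmod (hinner v w) * cmod (hinner w y)"
    using s by (intro norm_triangle_le) (simp add: norm_mult)
  also have "\<dots> \<le> s * (norm v * norm y) + cmod (hinner v w) * cmod (hinner w y)"
    using s norm_hinner_le by (intro add_right_mono mult_left_mono) auto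
  finally have "(cmod (of_real s * hinner v y + hinner v w * hinner w y))\<^sup>2
      \<le> (s * (norm v * norm y) + cmod (hinner v w) * cmod (hinner w y))\<^sup>2"
    by (intro power_mono) auto
  also have "\<dots> \<le> (s * (norm v)\<^sup>2 + (cmod (hinner v w))\<^sup>2) * (s * (norm y)\<^sup>2 + (cmod (hinner w y))\<^sup>2)"
  proof -
    have "0 \<le> s * (norm v * cmod (hinner w y) - norm y * cmod (hinner v w))\<^sup>2" using s by simp
    then show ?thesis by (simp add: power2_eq_square algebra_simps)
  qed
  finally show ?thesis
    unfolding eq using bergman_identity[of w z] by (simp add: y_def s_def)
qed

text \<open>The bound reads |(cosh r)'| <= sinh r times the Bergman speed: where r is positive it
  changes no faster than the length. Taking cosh r instead of r avoids the singularity at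
  \<open>\<gamma> t = z\<close>.\<close>

lemma bergman_cosh_derivative:
  fixes \<gamma> :: "real \<Rightarrow> complex ^ 'n"
  assumes z: "z \<in> ball 0 1" and w: "\<gamma> t \<in> ball 0 1"
    and \<gamma>: "(\<gamma> has_vector_derivative v) (at t)"
  obtains Q' where "((\<lambda>t. bergman_cosh z (\<gamma> t)) has_real_derivative Q') (at t)"
    "\<bar>Q'\<bar> \<le> sqrt ((bergman_cosh z (\<gamma> t))\<^sup>2 - 1) * bergman_norm (\<gamma> t) v"
proof -
  define w where "w = \<gamma> t"
  define s where "s = 1 - (norm w)\<^sup>2"
  define k where "k = 1 - (norm z)\<^sup>2"
  define a where "a = 1 - hinner w z"
  \<comment> \<open>The logarithmic derivative of \<open>bergman_cosh z (\<gamma> t)\<close> is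
    \<open>Re (b / a) / s\<close>; this \<open>b\<close> is the quantity estimated in
    \<open>bergman_cauchy_schwarz\<close>.\<close>
  define b where "b = a * hinner v w - of_real s * hinner v z"
  have pos: "0 < s" "0 < k" "a \<noteq> 0"
    using norm_less_1_square z w hinner_ne_1[of w z] by (auto simp: s_def k_def w_def a_def)
  have "((\<lambda>t. hinner (\<gamma> t) z) has_vector_derivative hinner v z) (at t)"
    by (rule bounded_linear.has_vector_derivative[OF bounded_linear_hinner_left \<gamma>])
  then have da: "((\<lambda>t. 1 - hinner (\<gamma> t) z) has_vector_derivative - hinner v z) (at t)"
    by (auto intro!: derivative_eq_intros)
  have ds: "((\<lambda>t. 1 - (norm (\<gamma> t))\<^sup>2) has_real_derivative - 2 * Re (hinner v w)) (at t)"
    using \<gamma> unfolding power2_norm_eq_inner has_vector_derivative_def has_field_derivative_def w_def Re_hinner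
    by (auto intro!: derivative_eq_intros simp: inner_commute fun_eq_iff)
  have dn: "((\<lambda>t. cmod (1 - hinner (\<gamma> t) z)) has_real_derivative - Re (cnj a * hinner v z) / cmod a) (at t)"
  proof -
    have "((\<lambda>t. cmod (1 - hinner (\<gamma> t) z)) has_derivative (\<lambda>h. (h *\<^sub>R (- hinner v z)) \<bullet> sgn a)) (at t)"
      by (rule has_derivative_compose[where g = norm, OF da[unfolded has_vector_derivative_def]])
         (use has_derivative_norm[of a] pos in \<open>simp add: a_def w_def\<close>)
    then show ?thesis
      unfolding has_field_derivative_def
      by (rule has_derivative_eq_rhs)
         (auto simp: fun_eq_iff inner_complex_def sgn_div_norm divide_inverse algebra_simps)
  qed
  define Q' where "Q' = Re (cnj a * b) / (cmod a * sqrt k * sqrt s * s)"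
  have Q: "((\<lambda>t. bergman_cosh z (\<gamma> t)) has_real_derivative Q') (at t)"
  proof -
    have "((\<lambda>t. k * (1 - (norm (\<gamma> t))\<^sup>2)) has_real_derivative k * (- 2 * Re (hinner v w))) (at t)"
      by (rule DERIV_cmult[OF ds])
    note DERIV_chain2[OF DERIV_real_sqrt this]
    then have "((\<lambda>t. sqrt (k * (1 - (norm (\<gamma> t))\<^sup>2))) has_real_derivative
        - k * Re (hinner v w) / sqrt (k * s)) (at t)"
      by (rule DERIV_cong)
         (use pos in \<open>auto simp: w_def[symmetric] s_def[symmetric] field_simps\<close>)
    note dq = DERIV_divide[OF dn this]
    have "((\<lambda>t. bergman_cosh z (\<gamma> t)) has_real_derivative
       ((- Re (cnj a * hinner v z) / cmod a) * sqrt (k * s)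
         - cmod a * ((- k * Re (hinner v w)) / sqrt (k * s))) / (sqrt (k * s))\<^sup>2) (at t)"
      unfolding bergman_cosh_def k_def[symmetric]
      by (rule DERIV_cong[OF dq])
         (use pos in \<open>simp_all add: w_def[symmetric] s_def[symmetric] a_def[symmetric]\<close>)
    moreover have "((- Re (cnj a * hinner v z) / cmod a) * sqrt (k * s)
         - cmod a * ((- k * Re (hinner v w)) / sqrt (k * s))) / (sqrt (k * s))\<^sup>2 = Q'"
    proof -
      have 1: "Re (cnj a * b) = (cmod a)\<^sup>2 * Re (hinner v w) - s * Re (cnj a * hinner v z)"
        unfolding cmod_power2 by (simp add: b_def power2_eq_square algebra_simps)
      have "((- Re (cnj a * hinner v z) / cmod a) * sqrt (k * s)
         - cmod a * ((- k * Re (hinner v w)) / sqrt (k * s))) / (sqrt (k * s))\<^sup>2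
        = (- Re (cnj a * hinner v z) * (sqrt (k * s))\<^sup>2 + (cmod a)\<^sup>2 * k * Re (hinner v w))
            / (cmod a * sqrt (k * s) * (sqrt (k * s))\<^sup>2)"
        using pos by (simp add: field_simps power2_eq_square)
      also have "\<dots> = k * Re (cnj a * b) / (cmod a * sqrt (k * s) * (k * s))"
        using pos unfolding 1 by (simp add: algebra_simps)
      also have "\<dots> = Q'" using pos by (simp add: Q'_def real_sqrt_mult field_simps)
      finally show ?thesis .
    qed
    ultimately show ?thesis by simp
  qed
  have "\<bar>Q'\<bar> \<le> cmod b / (sqrt k * sqrt s * s)"
  proof -
    have "\<bar>Re (cnj a * b)\<bar> \<le> cmod a * cmod b" using abs_Re_le_cmod[of "cnj a * b"] by (simp add: norm_mult)
    then show ?thesis using pos by (simp add: Q'_def abs_mult field_simps)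
  qed
  also have "cmod b \<le> sqrt ((s * (norm v)\<^sup>2 + (cmod (hinner v w))\<^sup>2) * ((cmod a)\<^sup>2 - k * s))"
    using bergman_cauchy_schwarz[of w z v] w by (intro real_le_rsqrt) (simp add: s_def k_def a_def b_def w_def)
  also have "\<dots> / (sqrt k * sqrt s * s)
    = sqrt ((bergman_cosh z w)\<^sup>2 - 1) * bergman_norm w v"
  proof -
    have "(bergman_cosh z w)\<^sup>2 - 1 = ((cmod a)\<^sup>2 - k * s) / (k * s)"
      using pos unfolding bergman_cosh_def a_def[symmetric] s_def[symmetric] k_def[symmetric]
      by (simp add: power_divide diff_divide_distrib)
    moreover have "bergman_norm w v = sqrt (s * (norm v)\<^sup>2 + (cmod (hinner v w))\<^sup>2) / s"
      using pos by (simp add: bergman_norm_eq s_def real_sqrt_divide)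
    ultimately show ?thesis using pos by (simp add: real_sqrt_divide real_sqrt_mult)
  qed
  finally show ?thesis using pos Q that by (simp add: w_def divide_right_mono)
qed


section \<open>Lengths of curves and the infimum\<close>

text \<open>Without integrability \<open>bergman_length\<close> would be the default value 0 and
  bound nothing. On each piece the integrand agrees, except at the two ends, with a function
  continuous up to the ends; the pieces are then joined.\<close>

lemma piecewise_smooth_curve_integrable:
  fixes \<gamma> :: "real \<Rightarrow> complex ^ 'n"
  assumes \<gamma>: "piecewise_smooth_curve \<gamma>" and im: "path_image \<gamma> \<subseteq> ball 0 1"
  obtains S where "finite S" "\<And>t. t \<in> {0<..<1} - S \<Longrightarrow> \<gamma> differentiable (at t)"
    "(\<lambda>t. bergman_norm (\<gamma> t) (vector_derivative \<gamma> (at t))) integrable_on {0..1}"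
proof -
  obtain S where S: "finite S" "{0, 1} \<subseteq> S" "S \<subseteq> {0..1}"
    and pw: "\<forall>a\<in>S. \<forall>b\<in>S. a < b \<and> {a<..<b} \<inter> S = {} \<longrightarrow>
        (\<exists>\<gamma>'. continuous_on {a..b} \<gamma>' \<and>
              (\<forall>t\<in>{a..b}. (\<gamma> has_vector_derivative \<gamma>' t) (at t within {a..b})))"
    using \<gamma> unfolding piecewise_smooth_curve_def by (elim conjE exE) (rule that)
  have pieces: "\<exists>\<gamma>'. continuous_on {a..b} \<gamma>' \<and>
              (\<forall>t\<in>{a..b}. (\<gamma> has_vector_derivative \<gamma>' t) (at t within {a..b}))"
    if "a \<in> S" "b \<in> S" "a < b" "{a<..<b} \<inter> S = {}" for a b
    by (rule pw[rule_format, OF that(1,2)]) (use that in simp)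
  define l where "l t = bergman_norm (\<gamma> t) (vector_derivative \<gamma> (at t))" for t
  have ball: "\<gamma> t \<in> ball 0 1" if "t \<in> {0..1}" for t
    using subsetD[OF im, of "\<gamma> t"] that by (simp add: path_image_def)
  have deriv: "(\<gamma> has_vector_derivative \<gamma>' t) (at t)"
    if "\<forall>t\<in>{a..b}. (\<gamma> has_vector_derivative \<gamma>' t) (at t within {a..b})" "t \<in> {a<..<b}" for \<gamma>' a b t
  proof -
    have "(\<gamma> has_vector_derivative \<gamma>' t) (at t within {a..b})" using that by auto
    then show ?thesis using that(2) by (simp add: at_within_Icc_at)
  qed
  have piece: "l integrable_on {a..b}" if ab: "a \<in> S" "b \<in> S" "a < b" "{a<..<b} \<inter> S = {}" for a b
  proof -
    obtain \<gamma>' where \<gamma>': "continuous_on {a..b} \<gamma>'"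
      "\<forall>t\<in>{a..b}. (\<gamma> has_vector_derivative \<gamma>' t) (at t within {a..b})" using pieces[OF ab] by blast
    have sub: "{a..b} \<subseteq> {0..1}" using ab S by auto
    have cont: "continuous_on {a..b} \<gamma>"
      using \<gamma>'(2) by (meson continuous_on_eq_continuous_within has_vector_derivative_continuous)
    have nz: "1 - (norm (\<gamma> t))\<^sup>2 \<noteq> 0" if "t \<in> {a..b}" for t
      using norm_less_1_square[OF ball[of t]] that sub by force
    have "continuous_on {a..b} (\<lambda>t. bergman_norm (\<gamma> t) (\<gamma>' t))"
      unfolding bergman_norm_eq hinner_def using nz
      by (intro continuous_intros cont \<gamma>'(1)) auto
    then have "(\<lambda>t. bergman_norm (\<gamma> t) (\<gamma>' t)) integrable_on {a..b}"
      by (rule integrable_continuous_real)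
    then show ?thesis
    proof (rule integrable_spike_finite[rotated 2])
      show "l t = bergman_norm (\<gamma> t) (\<gamma>' t)" if "t \<in> {a..b} - {a, b}" for t
        using vector_derivative_at[OF deriv[OF \<gamma>'(2)], of t] that by (auto simp: l_def)
    qed auto
  qed
  have prev: "\<exists>a\<in>S. a < b \<and> {a<..<b} \<inter> S = {}" if "b \<in> S" "0 < b" for b
  proof -
    define a where "a = Max (S \<inter> {..<b})"
    have ne: "finite (S \<inter> {..<b})" "S \<inter> {..<b} \<noteq> {}" using S that by auto
    have "a \<in> S \<inter> {..<b}" unfolding a_def using ne by (rule Max_in)
    moreover have "t \<le> a" if "t \<in> S \<inter> {..<b}" for t unfolding a_def using ne that by simp
    ultimately show ?thesis by (intro bexI[of _ a]) force+
  qed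
  \<comment> \<open>Induction on the number of break points before \<open>b\<close>; each step
    removes the last piece, from the predecessor \<open>a\<close> to \<open>b\<close>.\<close>
  have upto: "l integrable_on {0..b}" if "b \<in> S" for b
    using that
  proof (induction "card (S \<inter> {..<b})" arbitrary: b rule: less_induct)
    case less
    show ?case
    proof (cases "b = 0")
      case False
      then have "0 < b" using less.prems S by force
      then obtain a where a: "a \<in> S" "a < b" "{a<..<b} \<inter> S = {}" using prev less.prems by blast
      have "card (S \<inter> {..<a}) < card (S \<inter> {..<b})"
        using a S(1) by (intro psubset_card_mono) auto
      then have "l integrable_on {0..a}" using less.hyps a by blast
      moreover have "0 \<le> a" using a S by auto
      ultimately show ?thesis
        using piece[OF a(1) less.prems a(2,3)] a(2)
        by (intro Henstock_Kurzweil_Integration.integrable_combine[of 0 a b]) auto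
    qed (use integrable_on_refl[of l "0::real"] in simp)
  qed
  have "\<gamma> differentiable (at t)" if t: "t \<in> {0<..<1} - S" for t
  proof -
    \<comment> \<open>The next break point after \<open>t\<close>; together with its predecessor it
      bounds a piece with \<open>t\<close> in its interior.\<close>
    define b where "b = Min (S \<inter> {t<..})"
    have ne: "finite (S \<inter> {t<..})" "S \<inter> {t<..} \<noteq> {}" using S t by auto
    have b: "b \<in> S \<inter> {t<..}" unfolding b_def using ne by (rule Min_in)
    have b2: "b \<le> x" if "x \<in> S \<inter> {t<..}" for x unfolding b_def using ne that by simp
    have "0 < b" using b t by auto
    then obtain a where a: "a \<in> S" "a < b" "{a<..<b} \<inter> S = {}" using prev b by blast
    have "a < t" using a b2[of a] t by force
    obtain \<gamma>' where \<gamma>': "\<forall>t\<in>{a..b}. (\<gamma> has_vector_derivative \<gamma>' t) (at t within {a..b})"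
      using pieces[of a b] a b by blast
    show ?thesis
      using deriv[OF \<gamma>', of t] b \<open>a < t\<close> by (auto intro: differentiableI_vector)
  qed
  with S(1) upto[of 1] S(2) show ?thesis using that[of S] by (simp add: l_def[abs_def])
qed

text \<open>Since \<open>arcosh\<close> is not differentiable at \<open>1\<close>, the argument is shifted by \<open>\<epsilon>\<close>.\<close>

lemma arcosh_bergman_cosh_le_length:
  fixes \<gamma> :: "real \<Rightarrow> complex ^ 'n"
  assumes \<gamma>: "piecewise_smooth_curve \<gamma>" and im: "path_image \<gamma> \<subseteq> ball 0 1"
    and start: "pathstart \<gamma> = z" and fin: "pathfinish \<gamma> = w"
  shows "arcosh (bergman_cosh z w) \<le> bergman_length \<gamma>"
proof -
  define l where "l t = bergman_norm (\<gamma> t) (vector_derivative \<gamma> (at t))" for t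
  obtain S where S: "finite S" "\<And>t. t \<in> {0<..<1} - S \<Longrightarrow> \<gamma> differentiable (at t)"
    and int: "l integrable_on {0..1}"
    using piecewise_smooth_curve_integrable[OF \<gamma> im] unfolding l_def by metis
  have len: "bergman_length \<gamma> = integral {0..1} l"
    by (simp add: bergman_length_def l_def[abs_def] bergman_norm_def Let_def)
  have ball: "\<gamma> t \<in> ball 0 1" if "t \<in> {0..1}" for t
    using subsetD[OF im, of "\<gamma> t"] that by (simp add: path_image_def)
  have z: "z \<in> ball 0 1" and w: "w \<in> ball 0 1"
    using ball[of 0] ball[of 1] start fin by (auto simp: pathstart_def pathfinish_def)
  define Q where "Q t = bergman_cosh z (\<gamma> t)" for t
  have Q1: "1 \<le> Q t" if "t \<in> {0..1}" for t
    using bergman_cosh_ge_1[OF z ball[OF that]] by (simp add: Q_def)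
  have "\<exists>Q'. (Q has_real_derivative Q') (at t) \<and> \<bar>Q'\<bar> \<le> sqrt ((Q t)\<^sup>2 - 1) * l t"
    if t: "t \<in> {0<..<1} - S" for t
  proof -
    have d: "(\<gamma> has_vector_derivative vector_derivative \<gamma> (at t)) (at t)"
      using S(2)[OF t] by (simp add: vector_derivative_works)
    have t': "t \<in> {0..1}" using t by simp
    obtain D where "((\<lambda>t. bergman_cosh z (\<gamma> t)) has_real_derivative D) (at t)"
      "\<bar>D\<bar> \<le> sqrt ((bergman_cosh z (\<gamma> t))\<^sup>2 - 1) * bergman_norm (\<gamma> t) (vector_derivative \<gamma> (at t))"
      by (rule bergman_cosh_derivative[OF z ball[OF t'] d])
    then show ?thesis
      unfolding Q_def[abs_def] l_def by (intro exI[of _ D] conjI)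
  qed
  then obtain Q' where Q': "\<And>t. t \<in> {0<..<1} - S \<Longrightarrow> (Q has_real_derivative Q' t) (at t)"
    "\<And>t. t \<in> {0<..<1} - S \<Longrightarrow> \<bar>Q' t\<bar> \<le> sqrt ((Q t)\<^sup>2 - 1) * l t" by metis
  have cont\<gamma>: "continuous_on {0..1} \<gamma>" using \<gamma> by (simp add: piecewise_smooth_curve_def path_def)
  have contQ: "continuous_on {0..1} Q"
  proof -
    have nz: "(1 - (norm z)\<^sup>2) * (1 - (norm (\<gamma> t))\<^sup>2) > 0" if "t \<in> {0..1}" for t
      using norm_less_1_square[OF z] norm_less_1_square[OF ball[OF that]] by (rule mult_pos_pos)
    then show ?thesis
      unfolding Q_def[abs_def] bergman_cosh_def hinner_def
      by (intro continuous_intros cont\<gamma>) (metis less_irrefl real_sqrt_eq_zero_cancel_iff)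
  qed
  have l_nonneg: "0 \<le> l t" if "t \<in> {0..1}" for t
    using norm_less_1_square[OF ball[OF that]] unfolding l_def bergman_norm_eq by simp
  have eps: "arcosh (Q 1 + e) - arcosh (1 + e) \<le> bergman_length \<gamma>" if e: "0 < e" for e
  proof -
    define k' where "k' t = Q' t / sqrt ((Q t + e)\<^sup>2 - 1)" for t
    have k': "(k' has_integral (arcosh (Q 1 + e) - arcosh (Q 0 + e))) {0..1}"
    proof (rule fundamental_theorem_of_calculus_interior_strong[OF S(1)])
      show "((\<lambda>t. arcosh (Q t + e)) has_vector_derivative k' t) (at t)" if t: "t \<in> {0<..<1} - S" for t
      proof -
        have "1 < Q t + e" using Q1[of t] t e by auto
        then have "((\<lambda>t. arcosh (Q t + e)) has_real_derivative k' t) (at t)"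
          using DERIV_chain2[OF arcosh_real_has_field_derivative[of "Q t + e" UNIV]
              DERIV_add[OF Q'(1)[OF t] DERIV_const[of e]]] by (simp add: k'_def)
        then show ?thesis by (simp add: has_real_derivative_iff_has_vector_derivative)
      qed
      show "continuous_on {0..1} (\<lambda>t. arcosh (Q t + e))"
        using Q1 e by (intro continuous_intros contQ) force
    qed simp
    have l: "(l has_integral bergman_length \<gamma>) {0..1}"
      unfolding len using int by (rule integrable_integral)
    have le: "k' t \<le> l t" if t: "t \<in> {0..1} - ({0, 1} \<union> S)" for t
    proof -
      have t': "t \<in> {0<..<1} - S" "t \<in> {0..1}" using t by auto
      have q: "1 \<le> Q t" using Q1 t' by blast
      have "(Q t)\<^sup>2 < (Q t + e)\<^sup>2" using q e by (intro power_strict_mono) auto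
      then have "sqrt ((Q t)\<^sup>2 - 1) \<le> sqrt ((Q t + e)\<^sup>2 - 1)" "0 < sqrt ((Q t + e)\<^sup>2 - 1)"
        using one_le_power[OF q, of 2] by auto
      moreover have "Q' t \<le> sqrt ((Q t)\<^sup>2 - 1) * l t" using Q'(2)[OF t'(1)] by linarith
      ultimately have "Q' t \<le> sqrt ((Q t + e)\<^sup>2 - 1) * l t"
        using mult_right_mono[OF _ l_nonneg[OF t'(2)],
            of "sqrt ((Q t)\<^sup>2 - 1)" "sqrt ((Q t + e)\<^sup>2 - 1)"] by linarith
      then show ?thesis using \<open>0 < sqrt ((Q t + e)\<^sup>2 - 1)\<close> by (simp add: k'_def field_simps)
    qed
    \<comment> \<open>Nothing is known of \<open>Q'\<close> at the break points and the ends.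
      Changing \<open>k'\<close> to \<open>l\<close> at these finitely many points keeps the
      integral and makes the comparison with \<open>l\<close> hold everywhere.\<close>
    define k where "k t = (if t \<in> {0, 1} \<union> S then l t else k' t)" for t
    have "(k has_integral (arcosh (Q 1 + e) - arcosh (Q 0 + e))) {0..1}"
      by (rule has_integral_spike_finite[OF _ _ k', of "{0, 1} \<union> S"]) (use S(1) in \<open>auto simp: k_def\<close>)
    then have "arcosh (Q 1 + e) - arcosh (Q 0 + e) \<le> bergman_length \<gamma>"
      by (rule has_integral_le[OF _ l]) (use le in \<open>auto simp: k_def\<close>)
    moreover have "Q 0 = 1"
    proof -
      have "1 - hinner z z = of_real (1 - (norm z)\<^sup>2)" by (simp add: hinner_self)
      then show ?thesis
        using norm_less_1_square[OF z] start
        by (simp add: Q_def bergman_cosh_def pathstart_def norm_of_real del: of_real_diff of_real_power)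
    qed
    ultimately show ?thesis by simp
  qed
  \<comment> \<open>The shift is removed by the continuity of \<open>arcosh\<close> on [1,
    infinity), which includes the point where it is not differentiable.\<close>
  have "((\<lambda>e. arcosh (Q 1 + e) - arcosh (1 + e)) \<longlongrightarrow> arcosh (Q 1 + 0) - arcosh (1 + 0)) (at_right 0)"
  proof -
    have c: "continuous_on {0..} (\<lambda>e. arcosh (Q 1 + e) - arcosh (1 + e))"
      using Q1[of 1] by (intro continuous_intros) auto
    have "((\<lambda>e. arcosh (Q 1 + e) - arcosh (1 + e)) \<longlongrightarrow> arcosh (Q 1 + 0) - arcosh (1 + 0)) (at 0 within {0..})"
      using c[unfolded continuous_on_def, rule_format, of 0] by simp
    then show ?thesis by (rule tendsto_within_subset) auto
  qed
  then have "arcosh (Q 1 + 0) - arcosh (1 + 0) \<le> bergman_length \<gamma>"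
    by (rule tendsto_upperbound) (auto simp: eventually_at_right_less eps intro!: eventually_mono[OF eventually_at_right_less])
  then show ?thesis using fin by (simp add: Q_def pathfinish_def)
qed

lemma arcosh_bergman_cosh_le_dist:
  fixes z w :: "complex ^ 'n"
  assumes z: "z \<in> ball 0 1" and w: "w \<in> ball 0 1"
  shows "arcosh (bergman_cosh z w) \<le> bergman_dist z w"
  unfolding bergman_dist_def
proof (rule cInf_greatest)
  \<comment> \<open>The segment shows that the infimum is over a nonempty set, as
    \<open>cInf_greatest\<close> requires.\<close>
  define \<gamma> where "\<gamma> = linepath z w"
  have "(\<gamma> has_vector_derivative (w - z)) (at t within A)" for t A
    unfolding \<gamma>_def by (rule has_vector_derivative_linepath_within)
  then have "piecewise_smooth_curve \<gamma>"
    unfolding piecewise_smooth_curve_def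
    by (auto simp: \<gamma>_def intro!: exI[of _ "{0, 1}"] exI[of _ "\<lambda>_. w - z"])
  moreover have "path_image \<gamma> \<subseteq> ball 0 1"
    unfolding \<gamma>_def path_image_linepath using z w by (intro closed_segment_subset) auto
  moreover have "pathstart \<gamma> = z" "pathfinish \<gamma> = w" by (simp_all add: \<gamma>_def)
  ultimately show "bergman_length ` {\<gamma>. piecewise_smooth_curve \<gamma> \<and>
     path_image \<gamma> \<subseteq> ball 0 1 \<and> pathstart \<gamma> = z \<and> pathfinish \<gamma> = w} \<noteq> {}" by blast
qed (auto intro: arcosh_bergman_cosh_le_length)

text \<open>The left-hand side is the pseudohyperbolic distance. In terms of \<open>Q\<close> it is
  \<open>sqrt (1 - 1 / Q\<^sup>2)\<close>, which is \<open>tanh (arcosh Q)\<close>, and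
  \<open>tanh\<close> is monotone.\<close>

lemma tanh_bergman_dist_ge:
  fixes z w :: "complex ^ 'n"
  assumes z: "z \<in> ball 0 1" and w: "w \<in> ball 0 1"
  shows "sqrt (1 - (1 - (norm z)\<^sup>2) * (1 - (norm w)\<^sup>2) / (cmod (1 - hinner w z))\<^sup>2) \<le> tanh (bergman_dist z w)"
proof -
  define Q where "Q = bergman_cosh z w"
  have Q: "1 \<le> Q" using bergman_cosh_ge_1[OF z w] by (simp add: Q_def)
  have pos: "0 < (1 - (norm z)\<^sup>2) * (1 - (norm w)\<^sup>2)"
    using norm_less_1_square[OF z] norm_less_1_square[OF w] by (rule mult_pos_pos)
  have "sqrt (1 - (1 - (norm z)\<^sup>2) * (1 - (norm w)\<^sup>2) / (cmod (1 - hinner w z))\<^sup>2) = sqrt (1 - 1 / Q\<^sup>2)"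
    using pos by (simp add: Q_def bergman_cosh_def power_divide)
  also have "\<dots> = sqrt ((Q\<^sup>2 - 1) / Q\<^sup>2)" using Q by (simp add: diff_divide_distrib)
  also have "\<dots> = tanh (arcosh Q)"
    using Q by (simp add: tanh_def sinh_arcosh_real real_sqrt_divide)
  also have "\<dots> \<le> tanh (bergman_dist z w)"
    using arcosh_bergman_cosh_le_dist[OF z w] by (simp add: Q_def)
  finally show ?thesis .
qed

section \<open>Holomorphy of Jacobian determinants\<close>

text \<open>First-order Taylor formula. Cauchy's inequality on discs of radius \<open>e / 4\<close>
  about points of \<open>ball 0 (e / 2)\<close> bounds the second derivative by
  \<open>2 * B / (e / 4)\<^sup>2\<close>, whence the 32. The bound depends on \<open>f\<close> only
  through \<open>B\<close>, so it is uniform in parameters.\<close>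

lemma difference_quotient_bound:
  assumes hol: "f holomorphic_on ball 0 e" and B: "\<And>s. s \<in> ball 0 e \<Longrightarrow> cmod (f s) \<le> B"
    and e: "0 < e" and s: "cmod s < e / 2" "s \<noteq> 0"
  shows "cmod ((f s - f 0) / s - deriv f 0) \<le> 32 * B / e\<^sup>2 * cmod s"
proof -
  have B2: "cmod ((deriv ^^ 2) f x) \<le> 32 * B / e\<^sup>2" if x: "x \<in> ball 0 (e / 2)" for x
  proof -
    have sub: "cball x (e / 4) \<subseteq> ball 0 e"
    proof
      fix y assume "y \<in> cball x (e / 4)"
      then have "cmod y \<le> cmod x + e / 4" using norm_triangle_ineq3[of y x] by (simp add: dist_norm norm_minus_commute)
      then show "y \<in> ball 0 e" using x e by simp
    qed
    have "cmod ((deriv ^^ 2) f x) \<le> fact 2 * B / (e / 4)^2"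
    proof (rule Cauchy_inequality)
      show "f holomorphic_on ball x (e / 4)" using hol sub ball_subset_cball by (meson holomorphic_on_subset order_trans)
      show "continuous_on (cball x (e / 4)) f" using hol sub by (meson holomorphic_on_imp_continuous_on continuous_on_subset)
      show "cmod (f y) \<le> B" if "cmod (x - y) = e / 4" for y
        by (rule B) (use sub that in \<open>auto simp: dist_norm\<close>)
    qed (use e in simp)
    then show ?thesis by (simp add: power2_eq_square field_simps)
  qed
  have "cmod (f s - (\<Sum>i\<le>1. (deriv ^^ i) f 0 * (s - 0) ^ i / fact i)) \<le> 32 * B / e\<^sup>2 * cmod (s - 0) ^ Suc 1 / fact 1"
  proof (rule complex_Taylor[of "ball 0 (e / 2)" 1 "\<lambda>i. (deriv ^^ i) f", simplified funpow_0])
    show "((deriv ^^ i) f has_field_derivative (deriv ^^ Suc i) f x) (at x within ball 0 (e / 2))"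
      if "x \<in> ball 0 (e / 2)" for i x
    proof -
      have "(deriv ^^ i) f holomorphic_on ball 0 e" by (rule holomorphic_higher_deriv[OF hol]) simp
      then have "((deriv ^^ i) f has_field_derivative deriv ((deriv ^^ i) f) x) (at x)"
        by (rule holomorphic_derivI) (use that e in auto)
      then show ?thesis by (simp add: has_field_derivative_at_within)
    qed
    show "cmod ((deriv ^^ Suc 1) f x) \<le> 32 * B / e\<^sup>2" if "x \<in> ball 0 (e / 2)" for x
      using B2[OF that] by (simp add: numeral_2_eq_2)
  qed (use s e in auto)
  then have "cmod (f s - f 0 - deriv f 0 * s) \<le> 32 * B / e\<^sup>2 * cmod s * cmod s"
    by (simp add: power2_eq_square algebra_simps)
  moreover have "(f s - f 0) / s - deriv f 0 = (f s - f 0 - deriv f 0 * s) / s" using s by (simp add: field_simps)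
  ultimately show ?thesis using s(2) by (simp add: norm_divide field_simps)
qed

text \<open>The derivative in the second variable is a uniform limit of difference quotients
  \<open>q n\<close>, each of them holomorphic in the first variable.\<close>

lemma holomorphic_partial_derivative:
  fixes P :: "complex \<Rightarrow> complex \<Rightarrow> complex"
  assumes S: "open S" and e: "0 < e"
    and h1: "\<And>s. s \<in> ball 0 e \<Longrightarrow> (\<lambda>x. P x s) holomorphic_on S"
    and h2: "\<And>x. x \<in> S \<Longrightarrow> P x holomorphic_on ball 0 e"
    and B: "\<And>x s. x \<in> S \<Longrightarrow> s \<in> ball 0 e \<Longrightarrow> cmod (P x s) \<le> B"
  shows "(\<lambda>x. deriv (P x) 0) holomorphic_on S"
proof (rule holomorphic_uniform_sequence[OF S])
  define \<sigma> :: "nat \<Rightarrow> real" where "\<sigma> n = e / 4 / real (Suc n)" for n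
  have \<sigma>: "0 < \<sigma> n" "\<sigma> n < e / 2" for n
  proof -
    show "0 < \<sigma> n" using e by (simp add: \<sigma>_def)
    have "e / 4 / real (Suc n) \<le> e / 4 / 1" using e by (intro divide_left_mono) auto
    then show "\<sigma> n < e / 2" using e unfolding \<sigma>_def by linarith
  qed
  define q where "q n x = (P x (of_real (\<sigma> n)) - P x 0) / of_real (\<sigma> n)" for n x
  show "q n holomorphic_on S" for n
    unfolding q_def[abs_def] using \<sigma>[of n] e by (intro holomorphic_intros h1) auto
  have bound: "cmod (q n x - deriv (P x) 0) \<le> 32 * B / e\<^sup>2 * \<sigma> n" if "x \<in> S" for n x
    using difference_quotient_bound[OF h2[OF that] B[OF that] e, of "of_real (\<sigma> n)"] \<sigma>[of n]
    by (simp add: q_def)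
  have "(\<lambda>n. 32 * B / e\<^sup>2 * \<sigma> n) \<longlonglongrightarrow> 32 * B / e\<^sup>2 * 0"
    unfolding \<sigma>_def by (intro tendsto_mult tendsto_const) (use LIMSEQ_Suc[OF lim_const_over_n[of "e / 4"]] in simp)
  then have "(\<lambda>n. 32 * B / e\<^sup>2 * \<sigma> n) \<longlonglongrightarrow> 0" by simp
  then have lim: "\<forall>\<^sub>F n in sequentially. 32 * B / e\<^sup>2 * \<sigma> n < r" if "0 < r" for r
    using that by (rule order_tendstoD(2))
  have unif: "uniform_limit S q (\<lambda>x. deriv (P x) 0) sequentially"
  proof (rule uniform_limitI)
    fix r :: real assume "0 < r"
    from lim[OF this] show "\<forall>\<^sub>F n in sequentially. \<forall>x\<in>S. dist (q n x) (deriv (P x) 0) < r"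
      by (rule eventually_mono) (auto simp: dist_norm intro: le_less_trans[OF bound])
  qed
  show "\<exists>d>0. cball x d \<subseteq> S \<and> uniform_limit (cball x d) q (\<lambda>x. deriv (P x) 0) sequentially"
    if "x \<in> S" for x
  proof -
    have "\<exists>d>0. cball x d \<subseteq> S"
      using S that by (simp only: open_contains_cball)
    then obtain d where "0 < d" "cball x d \<subseteq> S" by blast
    then show ?thesis by (intro exI[of _ d] conjI uniform_limit_on_subset[OF unif])
  qed
qed

lemma holomorphic_map_on_line:
  assumes h: "holomorphic_map_on h S"
    and sub: "\<And>s. s \<in> T \<Longrightarrow> a + s *s v \<in> S"
  shows "(\<lambda>s. h (a + s *s v) $ i) holomorphic_on T"
  unfolding holomorphic_on_def field_differentiable_def
proof
  fix s assume "s \<in> T"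
  then obtain A where A: "(h has_derivative (\<lambda>v. A *v v)) (at (a + s *s v))"
    using h sub unfolding holomorphic_map_on_def by blast
  have "linear (\<lambda>s. s *s v)" by (auto intro!: linearI simp: vec_eq_iff algebra_simps)
  then have "((\<lambda>s. a + s *s v) has_derivative (\<lambda>s. s *s v)) (at s)"
    by (auto intro!: derivative_eq_intros linear_imp_has_derivative)
  from has_derivative_compose[OF this A] have "((\<lambda>s. h (a + s *s v)) has_derivative (\<lambda>s. A *v (s *s v))) (at s)" .
  from bounded_linear.has_derivative[OF bounded_linear_vec_nth this, of i]
  have "((\<lambda>s. h (a + s *s v) $ i) has_field_derivative (A *v v) $ i) (at s)"
    unfolding has_field_derivative_def
    by (rule has_derivative_eq_rhs) (simp add: fun_eq_iff vector_scalar_commute mult.commute)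
  then show "\<exists>D. ((\<lambda>s. h (a + s *s v) $ i) has_field_derivative D) (at s within T)"
    by (blast intro: has_field_derivative_at_within)
qed

lemma norm_vec_scale: "norm (c *s (v :: complex ^ 'n)) = cmod c * norm v"
  by (simp add: norm_vec_def L2_set_def norm_mult power_mult_distrib sum_distrib_left[symmetric] real_sqrt_mult)

text \<open>\<open>holomorphic_map_on\<close> gives a first derivative at each point and says
  nothing of its regularity. Each entry of the Jacobian is therefore treated as a partial derivative
  of a function of two complex variables, the parameter of the line and a coordinate
  direction.\<close>

lemma holomorphic_det_jacobian_on_line:
  fixes h :: "complex ^ 'n \<Rightarrow> complex ^ 'n"
  assumes h: "holomorphic_map_on h (ball 0 1)"
    and sub: "\<And>s. s \<in> T \<Longrightarrow> a + s *s v \<in> ball 0 1"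
  shows "(\<lambda>s. det (jacobian h (a + s *s v))) holomorphic_on T"
proof -
  have entry: "(\<lambda>s. jacobian h (a + s *s v) $ i $ j) holomorphic_on T" for i j
    unfolding holomorphic_on_def
  proof
    fix s0 assume "s0 \<in> T"
    define m where "m = norm (a + s0 *s v)"
    have m: "m < 1" using sub[OF \<open>s0 \<in> T\<close>] by (simp add: m_def)
    \<comment> \<open>\<open>r\<close> lies halfway between \<open>m\<close> and 1. Moving by
      \<open>e\<close> along the line and by \<open>e\<close> along an axis costs at most
      \<open>(1 - m) / 4\<close> each, together \<open>r - m\<close>; the summand 1 in the
      denominator of \<open>e\<close> covers \<open>v = 0\<close>.\<close>
    define r where "r = (m + 1) / 2"
    define e where "e = (1 - m) / 4 / (norm v + 1)"
    have e: "0 < e" "e \<le> (1 - m) / 4" "e * norm v \<le> (1 - m) / 4"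
    proof -
      have N: "0 < norm v + 1" by (simp add: add_nonneg_pos)
      show "0 < e" using m N by (simp add: e_def)
      have "x / y * y = x" if "0 < y" for x y :: real using that by simp
      from this[OF N] have "e * (norm v + 1) = (1 - m) / 4" unfolding e_def .
      then have "e * norm v + e = (1 - m) / 4" by (simp only: distrib_left mult_1_right)
      moreover have "0 \<le> e * norm v" using \<open>0 < e\<close> by simp
      ultimately show "e \<le> (1 - m) / 4" "e * norm v \<le> (1 - m) / 4"
        using \<open>0 < e\<close> by linarith+
    qed
    have near: "a + s *s v + t *s axis j 1 \<in> cball 0 r"
      if "s \<in> ball s0 e" "t \<in> ball 0 e" for s t
    proof -
      have "a + s *s v + t *s axis j 1 = (a + s0 *s v) + ((s - s0) *s v + t *s axis j 1)"
        by (simp add: vec_eq_iff algebra_simps)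
      then have "norm (a + s *s v + t *s axis j 1)
          \<le> m + (cmod (s - s0) * norm v + cmod t * norm (axis j (1::complex) :: complex ^ 'n))"
        unfolding m_def norm_vec_scale[symmetric]
        by (simp only:) (intro norm_triangle_mono order_refl)
      moreover have "cmod (s - s0) * norm v \<le> e * norm v"
        using that by (intro mult_right_mono) (auto simp: dist_norm norm_minus_commute)
      moreover have "norm (axis j (1::complex) :: complex ^ 'n) = 1"
        by (simp add: norm_eq_sqrt_inner inner_axis_axis)
      moreover have "cmod t < e" using that by simp
      ultimately have "norm (a + s *s v + t *s axis j 1) \<le> r"
        using e unfolding r_def by simp
      then show ?thesis by simp
    qed
    have r: "cball 0 r \<subseteq> ball (0 :: complex ^ 'n) 1" using m by (auto simp: r_def)
    have "continuous_on (cball 0 r) h"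
    proof (intro continuous_at_imp_continuous_on ballI)
      fix x :: "complex ^ 'n" assume "x \<in> cball 0 r"
      then have "x \<in> ball 0 1" using r by blast
      then obtain A where "(h has_derivative (\<lambda>v. A *v v)) (at x)"
        using h unfolding holomorphic_map_on_def by blast
      then show "isCont h x" by (rule has_derivative_continuous)
    qed
    then have "bounded (h ` cball 0 r)" by (intro compact_imp_bounded compact_continuous_image) auto
    then obtain B where B: "\<And>x. x \<in> cball 0 r \<Longrightarrow> norm (h x) \<le> B"
      unfolding bounded_iff by blast
    have "(\<lambda>s. deriv (\<lambda>t. h (a + s *s v + t *s axis j 1) $ i) 0) holomorphic_on ball s0 e"
    proof (rule holomorphic_partial_derivative[OF open_ball e(1)])
      show "(\<lambda>s. h (a + s *s v + t *s axis j 1) $ i) holomorphic_on ball s0 e" if "t \<in> ball 0 e" for t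
      proof -
        have "(a + t *s axis j 1) + s *s v \<in> ball 0 1" if "s \<in> ball s0 e" for s
          using subsetD[OF r near[OF that \<open>t \<in> ball 0 e\<close>]] by (simp only: add_ac)
        from holomorphic_map_on_line[OF h this]
        have "(\<lambda>s. h ((a + t *s axis j 1) + s *s v) $ i) holomorphic_on ball s0 e" .
        then show ?thesis by (simp only: add_ac)
      qed
      show "(\<lambda>t. h (a + s *s v + t *s axis j 1) $ i) holomorphic_on ball 0 e" if s: "s \<in> ball s0 e" for s
      proof -
        have "a + s *s v + t *s axis j 1 \<in> ball 0 1" if "t \<in> ball 0 e" for t
          by (rule subsetD[OF r near[OF s that]])
        from holomorphic_map_on_line[OF h this] show ?thesis .
      qed
      show "cmod (h (a + s *s v + t *s axis j 1) $ i) \<le> B" if "s \<in> ball s0 e" "t \<in> ball 0 e" for s t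
        by (rule order_trans[OF Finite_Cartesian_Product.norm_nth_le B[OF near[OF that]]])
    qed
    from holomorphic_on_imp_differentiable_at[OF this open_ball]
    have "(\<lambda>s. jacobian h (a + s *s v) $ i $ j) field_differentiable at s0"
      using e(1) by (simp add: jacobian_def)
    then show "(\<lambda>s. jacobian h (a + s *s v) $ i $ j) field_differentiable at s0 within T"
      by (rule field_differentiable_at_within)
  qed
  show ?thesis unfolding det_def
    by (intro holomorphic_on_sum holomorphic_on_mult holomorphic_on_const holomorphic_on_prod entry)
qed

section \<open>Weighted Schwarz--Pick estimates\<close>

text \<open>The Schwarz lemma for the composition of \<open>g\<close> with the Moebius map sending
  \<open>g 0\<close> to 0, weakened in two steps: the values are replaced by their moduli, then the
  factor \<open>1 - x * y\<close> is bounded by 1.\<close>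

lemma Schwarz_Pick_norm:
  assumes hol: "g holomorphic_on ball 0 1" and lt: "\<And>z. cmod z < 1 \<Longrightarrow> cmod (g z) < 1"
    and z: "cmod z < 1"
  shows "cmod (g z) - cmod (g 0) \<le> cmod z"
proof -
  define a where "a = g 0"
  have a: "cmod a < 1" using lt by (simp add: a_def)
  define k where "k = Moebius_function 0 a \<circ> g"
  have "cmod (k z) \<le> cmod z"
  proof (rule Schwarz_Lemma(1))
    show "k holomorphic_on ball 0 1"
      unfolding k_def using lt
      by (intro holomorphic_on_compose_gen[OF hol Moebius_function_holomorphic[OF a]]) auto
    show "k 0 = 0" by (simp add: k_def a_def Moebius_function_eq_zero)
    show "cmod (k w) < 1" if "cmod w < 1" for w
      unfolding k_def o_def by (rule Moebius_function_norm_lt_1[OF a lt[OF that]])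
  qed (rule z)
  define b where "b = g z"
  have b: "cmod b < 1" using lt z by (simp add: b_def)
  define x where "x = cmod b"
  define y where "y = cmod a"
  have xy: "0 \<le> x" "x < 1" "0 \<le> y" "y < 1" using a b by (auto simp: x_def y_def)
  have "cmod (b - a) \<le> cmod z * cmod (1 - cnj a * b)"
  proof -
    have "cmod (cnj a * b) < 1 * 1" unfolding norm_mult using a b by (intro mult_strict_mono') auto
    then have "1 - cnj a * b \<noteq> 0" by auto
    then show ?thesis
      using \<open>cmod (k z) \<le> cmod z\<close> by (simp add: k_def Moebius_function_simple b_def norm_divide field_simps)
  qed
  then have sq: "(cmod (b - a))\<^sup>2 \<le> (cmod z)\<^sup>2 * (cmod (1 - cnj a * b))\<^sup>2"
    by (metis norm_ge_zero power_mono power_mult_distrib)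
  have 1: "(cmod (b - a))\<^sup>2 = x\<^sup>2 + y\<^sup>2 - 2 * Re (cnj a * b)"
    "(cmod (1 - cnj a * b))\<^sup>2 = 1 + x\<^sup>2 * y\<^sup>2 - 2 * Re (cnj a * b)"
    unfolding x_def y_def cmod_power2 by (simp_all add: power2_eq_square algebra_simps)
  have "Re (cnj a * b) \<le> x * y"
    using complex_Re_le_cmod[of "cnj a * b"] by (simp add: norm_mult x_def y_def mult.commute)
  \<comment> \<open>Replacing \<open>Re (cnj a * b)\<close> by its upper bound \<open>x * y\<close>
    lowers the right-hand side of \<open>sq\<close> by only \<open>(cmod z)\<^sup>2\<close> times
    what it takes from the left-hand side, so the inequality survives.\<close>
  then have "0 \<le> (1 - (cmod z)\<^sup>2) * (x * y - Re (cnj a * b))"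
    using z by (intro mult_nonneg_nonneg) (auto simp: abs_square_le_1)
  then have "(x - y)\<^sup>2 \<le> (cmod z)\<^sup>2 * (1 - x * y)\<^sup>2"
    using sq unfolding 1 by (simp add: power2_eq_square algebra_simps)
  then have "(x - y)\<^sup>2 \<le> (cmod z * (1 - x * y))\<^sup>2" by (simp add: power_mult_distrib)
  moreover have xy1: "0 \<le> x * y" "x * y \<le> 1" using xy by (auto intro: mult_le_one)
  ultimately have "x - y \<le> cmod z * (1 - x * y)"
    by (intro power2_le_imp_le[of "x - y" "cmod z * (1 - x * y)"]) simp_all
  also have "\<dots> \<le> cmod z" using xy1 by (simp add: mult_left_le)
  finally show ?thesis by (simp add: x_def y_def a_def b_def)
qed

text \<open>The radius \<open>R\<close> below minimises \<open>(1 - R\<^sup>2) powr (- \<alpha>) / R\<close>, the constant that Schwarz--Pick gives on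
  the disc of radius \<open>R\<close>.\<close>

lemma weighted_disc_origin:
  fixes \<alpha> K :: real
  assumes \<alpha>: "0 < \<alpha>" and hol: "v holomorphic_on ball 0 1"
    and bound: "\<And>z. cmod z < 1 \<Longrightarrow> (1 - (cmod z)\<^sup>2) powr \<alpha> * cmod (v z) \<le> K"
    and z: "cmod z < 1"
  shows "(1 - (cmod z)\<^sup>2) powr \<alpha> * cmod (v z) - cmod (v 0)
    \<le> sqrt (2 * \<alpha> + 1) * ((2 * \<alpha> + 1) / (2 * \<alpha>)) powr \<alpha> * K * cmod z"
proof -
  define R where "R = 1 / sqrt (2 * \<alpha> + 1)"
  define M where "M = (1 - R\<^sup>2) powr (- \<alpha>)"
  have R2: "R\<^sup>2 = 1 / (2 * \<alpha> + 1)" using \<alpha> by (simp add: R_def power_divide)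
  have R: "0 < R" "R < 1" using \<alpha> by (auto simp: R_def)
  have R1: "1 - R\<^sup>2 = 2 * \<alpha> / (2 * \<alpha> + 1)" using \<alpha> by (simp add: R2 field_simps)
  have M: "M = ((2 * \<alpha> + 1) / (2 * \<alpha>)) powr \<alpha>"
    using \<alpha> by (simp add: M_def R1 powr_minus powr_divide)
  have M1: "1 \<le> M" unfolding M using \<alpha> by (intro ge_one_powr_ge_zero) auto
  have "cmod (v 0) \<le> K" using bound[of 0] by simp
  then have K: "0 \<le> K" using norm_ge_zero[of "v 0"] by linarith
  have w: "0 < 1 - (cmod s)\<^sup>2" "(1 - (cmod s)\<^sup>2) powr \<alpha> \<le> 1" if "cmod s < 1" for s :: complex
  proof -
    show "0 < 1 - (cmod s)\<^sup>2" using that by (simp add: abs_square_less_1)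
    then have "\<bar>1 - (cmod s)\<^sup>2\<bar> \<le> 1" using zero_le_power2[of "cmod s"] by linarith
    then show "(1 - (cmod s)\<^sup>2) powr \<alpha> \<le> 1" using \<alpha> by (intro powr_le1) auto
  qed
  have "(1 - (cmod z)\<^sup>2) powr \<alpha> * cmod (v z) - cmod (v 0) \<le> M * K * (cmod z / R)"
  proof (cases "R \<le> cmod z")
    \<comment> \<open>Far from the origin the trivial bound \<open>K\<close> is enough, since
      \<open>M\<close> and \<open>cmod z / R\<close> are both at least 1.\<close>
    case True
    have "(1 - (cmod z)\<^sup>2) powr \<alpha> * cmod (v z) - cmod (v 0) \<le> 1 * K * 1"
      using bound[OF z] norm_ge_zero[of "v 0"] by linarith
    also have "\<dots> \<le> M * K * (cmod z / R)"
      using M1 K R True by (intro mult_mono) (auto simp: field_simps)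
    finally show ?thesis .
  next
    case small: False
    show ?thesis
    proof (cases "K = 0")
      case True
      then have "(1 - (cmod z)\<^sup>2) powr \<alpha> * cmod (v z) \<le> 0" using bound[OF z] by simp
      then show ?thesis unfolding True using norm_ge_zero[of "v 0"] by linarith
    next
      case False
      then have "0 < K" using K by simp
      \<comment> \<open>On the disc of radius \<open>R\<close> the weight exceeds
        \<open>1 / M\<close>, so \<open>v\<close> is smaller than \<open>M * K\<close> there;
        rescaling gives a self-map of the unit disc. The division is why \<open>K = 0\<close> is
        treated apart.\<close>
      define g where "g s = v (of_real R * s) / of_real (M * K)" for s
      have in_ball: "cmod (of_real R * s) < R" if "cmod s < 1" for s
        using that R by (simp add: norm_mult)
      have "cmod (g (z / of_real R)) - cmod (g 0) \<le> cmod (z / of_real R)"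
      proof (rule Schwarz_Pick_norm)
        show "g holomorphic_on ball 0 1"
          unfolding g_def
        proof (intro holomorphic_intros holomorphic_on_compose_gen[OF _ hol, unfolded o_def])
          show "(\<lambda>s. complex_of_real R * s) ` ball 0 1 \<subseteq> ball 0 1"
            using less_trans[OF in_ball R(2)] by (intro image_subsetI) simp
          show "complex_of_real (M * K) \<noteq> 0" using M1 \<open>0 < K\<close> by simp
        qed
        show "cmod (g s) < 1" if "cmod s < 1" for s
        proof -
          define t where "t = of_real R * s"
          have t: "cmod t < R" "cmod t < 1" using in_ball[OF that] R by (auto simp: t_def)
          then have "(cmod t)\<^sup>2 < R\<^sup>2" by (intro power_strict_mono) auto
          moreover have "0 < 1 - R\<^sup>2" using \<alpha> by (simp add: R1)
          ultimately have "(1 - R\<^sup>2) powr \<alpha> < (1 - (cmod t)\<^sup>2) powr \<alpha>"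
            using \<alpha> by (intro powr_less_mono2) auto
          moreover have "0 < (1 - R\<^sup>2) powr \<alpha>" using \<open>0 < 1 - R\<^sup>2\<close> by simp
          ultimately have "(1 - R\<^sup>2) powr \<alpha> * cmod (v t) < K"
            using bound[OF t(2)] \<open>0 < K\<close>
            by (cases "v t = 0") (auto intro: less_le_trans[OF mult_strict_right_mono])
          then show ?thesis
            using \<open>0 < K\<close> M1 \<open>0 < (1 - R\<^sup>2) powr \<alpha>\<close>
            by (simp add: g_def t_def norm_divide norm_mult M_def powr_minus field_simps)
        qed
        show "cmod (z / of_real R) < 1" using small R by (simp add: norm_divide)
      qed
      then have "cmod (v z) - cmod (v 0) \<le> M * K * (cmod z / R)"
        using R M1 \<open>0 < K\<close> by (simp add: g_def norm_divide norm_mult field_simps)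
      \<comment> \<open>The weight equals 1 at the origin and is at most 1 at \<open>z\<close>, so
        dropping it only enlarges the difference.\<close>
      moreover have "(1 - (cmod z)\<^sup>2) powr \<alpha> * cmod (v z) \<le> 1 * cmod (v z)"
        using w[OF z] by (intro mult_right_mono) auto
      ultimately show ?thesis by simp
    qed
  qed
  also have "M * K * (cmod z / R) = sqrt (2 * \<alpha> + 1) * M * K * cmod z" by (simp add: R_def)
  finally show ?thesis by (simp add: M)
qed

section \<open>Transport to arbitrary points of the disc and of the ball\<close>

lemma Moebius_function_norm:
  assumes "cmod w < 1" "cmod z < 1"
  shows "1 - (cmod (Moebius_function 0 w z))\<^sup>2
    = (1 - (cmod w)\<^sup>2) * (1 - (cmod z)\<^sup>2) / (cmod (1 - cnj w * z))\<^sup>2"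
proof -
  have "cmod (cnj w * z) < 1 * 1" unfolding norm_mult using assms by (intro mult_strict_mono') auto
  then have "1 - cnj w * z \<noteq> 0" by auto
  then have "1 - (cmod (Moebius_function 0 w z))\<^sup>2
    = ((cmod (1 - cnj w * z))\<^sup>2 - (cmod (z - w))\<^sup>2) / (cmod (1 - cnj w * z))\<^sup>2"
    unfolding Moebius_function_simple norm_divide power_divide by (simp add: diff_divide_distrib)
  also have "(cmod (1 - cnj w * z))\<^sup>2 - (cmod (z - w))\<^sup>2 = (1 - (cmod w)\<^sup>2) * (1 - (cmod z)\<^sup>2)"
    unfolding cmod_power2 by (simp add: power2_eq_square algebra_simps)
  finally show ?thesis .
qed

text \<open>The exponent is half a natural number so that the automorphy factor \<open>(1 + cnj a * s) ^ N\<close> is holomorphic.\<close>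

lemma weighted_disc:
  fixes N :: nat and K :: real
  assumes N: "0 < N" and hol: "U holomorphic_on ball 0 1"
    and bound: "\<And>z. cmod z < 1 \<Longrightarrow> (1 - (cmod z)\<^sup>2) powr (real N / 2) * cmod (U z) \<le> K"
    and a: "cmod a < 1" and b: "cmod b < 1"
  shows "(1 - (cmod b)\<^sup>2) powr (real N / 2) * cmod (U b) - (1 - (cmod a)\<^sup>2) powr (real N / 2) * cmod (U a)
    \<le> sqrt (real N + 1) * ((real N + 1) / real N) powr (real N / 2) * K
        * sqrt (1 - (1 - (cmod a)\<^sup>2) * (1 - (cmod b)\<^sup>2) / (cmod (1 - b * cnj a))\<^sup>2)"
proof -
  define \<phi> where "\<phi> = Moebius_function 0 (- a)"
  \<comment> \<open>The pullback of \<open>U\<close> under the automorphism \<open>\<phi>\<close>,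
    which sends 0 to \<open>a\<close>; the automorphy factor is chosen so that the weighted modulus
    is preserved, as \<open>weight\<close> states.\<close>
  define v where "v s = of_real ((1 - (cmod a)\<^sup>2) powr (real N / 2)) * U (\<phi> s) / (1 + cnj a * s) ^ N" for s
  define s where "s = Moebius_function 0 a b"
  have na: "cmod (- a) < 1" using a by simp
  have nz: "1 + cnj a * t \<noteq> 0" if "cmod t < 1" for t
  proof -
    have "cmod (cnj a * t) < 1 * 1" unfolding norm_mult using a that by (intro mult_strict_mono') auto
    then show ?thesis using norm_minus_cancel[of 1] by (metis add_eq_0_iff less_irrefl mult_1 norm_minus_cancel norm_one)
  qed
  have weight: "(1 - (cmod t)\<^sup>2) powr (real N / 2) * cmod (v t) = (1 - (cmod (\<phi> t))\<^sup>2) powr (real N / 2) * cmod (U (\<phi> t))"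
    if t: "cmod t < 1" for t
  proof -
    have pos: "0 < 1 - (cmod a)\<^sup>2" "0 < 1 - (cmod t)\<^sup>2" "0 < cmod (1 + cnj a * t)"
      using a t nz[OF t] by (auto simp: abs_square_less_1)
    have "1 - (cmod (\<phi> t))\<^sup>2 = (1 - (cmod a)\<^sup>2) * (1 - (cmod t)\<^sup>2) / (cmod (1 + cnj a * t))\<^sup>2"
      using Moebius_function_norm[OF na t] by (simp add: \<phi>_def)
    then have "(1 - (cmod (\<phi> t))\<^sup>2) powr (real N / 2)
      = (1 - (cmod a)\<^sup>2) powr (real N / 2) * (1 - (cmod t)\<^sup>2) powr (real N / 2) / ((cmod (1 + cnj a * t))\<^sup>2) powr (real N / 2)"
      using pos by (simp add: powr_divide powr_mult)
    also have "((cmod (1 + cnj a * t))\<^sup>2) powr (real N / 2) = cmod (1 + cnj a * t) ^ N"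
      using pos by (simp add: powr_power[symmetric] powr_powr flip: powr_realpow powr_numeral)
    finally show ?thesis
      by (simp add: v_def norm_divide norm_mult norm_power mult_ac)
  qed
  have I: "(1 - (cmod s)\<^sup>2) powr (real N / 2) * cmod (v s) - cmod (v 0)
      \<le> sqrt (2 * (real N / 2) + 1) * ((2 * (real N / 2) + 1) / (2 * (real N / 2))) powr (real N / 2) * K * cmod s"
  proof (rule weighted_disc_origin)
    have "U \<circ> \<phi> holomorphic_on ball 0 1"
      unfolding \<phi>_def using Moebius_function_norm_lt_1[OF na]
      by (intro holomorphic_on_compose_gen[OF Moebius_function_holomorphic[OF na] hol]) auto
    then show "v holomorphic_on ball 0 1"
      unfolding v_def[abs_def] o_def using nz by (intro holomorphic_intros) auto
    show "(1 - (cmod t)\<^sup>2) powr (real N / 2) * cmod (v t) \<le> K" if "cmod t < 1" for t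
      unfolding weight[OF that] using bound Moebius_function_norm_lt_1[OF na that] by (simp add: \<phi>_def)
    show "cmod s < 1" unfolding s_def by (rule Moebius_function_norm_lt_1[OF a b])
  qed (use N in simp)
  have "\<phi> s = b"
    unfolding \<phi>_def s_def by (rule Moebius_function_compose) (use a b in auto)
  moreover have "cmod s < 1" unfolding s_def by (rule Moebius_function_norm_lt_1[OF a b])
  ultimately have W: "(1 - (cmod s)\<^sup>2) powr (real N / 2) * cmod (v s) = (1 - (cmod b)\<^sup>2) powr (real N / 2) * cmod (U b)"
    using weight[of s] by simp
  have v0: "cmod (v 0) = (1 - (cmod a)\<^sup>2) powr (real N / 2) * cmod (U a)"
    using weight[of 0] by (simp add: \<phi>_def Moebius_function_simple)
  have s_eq: "cmod s = sqrt (1 - (1 - (cmod a)\<^sup>2) * (1 - (cmod b)\<^sup>2) / (cmod (1 - b * cnj a))\<^sup>2)"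
    using Moebius_function_norm[OF a b] unfolding s_def[symmetric]
    by (intro real_sqrt_unique[symmetric]) (simp_all add: mult.commute)
  show ?thesis using I[unfolded W v0] unfolding s_eq by (simp add: add.commute)
qed

text \<open>A complex affine line meets the ball in a disc \<open>p + R\<eta>q\<close> with \<open>p \<bottom> q\<close>, on which
  \<open>1 - \<bar>\<cdot>\<bar>\<^sup>2 = R\<^sup>2 (1 - \<bar>\<eta>\<bar>\<^sup>2)\<close>.\<close>

lemma weighted_ball:
  fixes N :: nat and K :: real and z w :: "complex ^ 'n"
  assumes N: "0 < N"
    and hol: "\<And>a v T. (\<And>s. s \<in> T \<Longrightarrow> a + s *s v \<in> ball 0 1) \<Longrightarrow> (\<lambda>s. u (a + s *s v)) holomorphic_on T"
    and bound: "\<And>z. z \<in> ball 0 1 \<Longrightarrow> (1 - (norm z)\<^sup>2) powr (real N / 2) * cmod (u z) \<le> K"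
    and z: "z \<in> ball 0 1" and w: "w \<in> ball 0 1"
  shows "(1 - (norm w)\<^sup>2) powr (real N / 2) * cmod (u w) - (1 - (norm z)\<^sup>2) powr (real N / 2) * cmod (u z)
    \<le> sqrt (real N + 1) * ((real N + 1) / real N) powr (real N / 2) * K
        * sqrt (1 - (1 - (norm z)\<^sup>2) * (1 - (norm w)\<^sup>2) / (cmod (1 - hinner w z))\<^sup>2)"
proof -
  obtain q :: "complex ^ 'n" and c where q: "norm q = 1" and wz: "w = z + c *s q"
  proof (cases "w = z")
    case True
    have "norm (axis undefined 1 :: complex ^ 'n) = 1" by (simp add: norm_eq_sqrt_inner inner_axis_axis)
    with True show ?thesis using that[of "axis undefined 1" 0] by simp
  next
    case False
    then have "norm (sgn (w - z)) = 1" by (simp add: norm_sgn)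
    moreover have "w = z + of_real (norm (w - z)) *s sgn (w - z)"
    proof -
      have "of_real r *s x = r *\<^sub>R x" for r and x :: "complex ^ 'n"
        by (simp add: vec_eq_iff scaleR_conv_of_real[where 'a=complex])
      then show ?thesis using False by (simp add: sgn_div_norm)
    qed
    ultimately show ?thesis using that by blast
  qed
  define \<zeta> where "\<zeta> = hinner z q"
  \<comment> \<open>The foot of the perpendicular from the origin to the complex line, hence the
    centre of the disc in which the line meets the ball.\<close>
  define p where "p = z - \<zeta> *s q"
  have qq: "hinner q q = 1" using q by (simp add: hinner_self)
  have pq: "hinner p q = 0" "hinner q p = 0"
    using hinner_commute[of q p] by (simp_all add: p_def \<zeta>_def hinner_simps qq)
  have zw: "z = p + \<zeta> *s q" "w = p + (\<zeta> + c) *s q"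
    using wz by (simp_all add: p_def vec_eq_iff algebra_simps)
  have hin: "hinner (p + x *s q) (p + y *s q) = of_real ((norm p)\<^sup>2) + x * cnj y" for x y
    using pq qq by (simp add: hinner_simps hinner_self)
  have nrm: "(norm (p + x *s q))\<^sup>2 = (norm p)\<^sup>2 + (cmod x)\<^sup>2" for x
  proof -
    have "complex_of_real ((norm (p + x *s q))\<^sup>2) = of_real ((norm p)\<^sup>2) + x * cnj x"
      unfolding hin[symmetric] by (rule hinner_self[symmetric])
    then have "complex_of_real ((norm (p + x *s q))\<^sup>2) = of_real ((norm p)\<^sup>2 + (cmod x)\<^sup>2)"
      by (simp only: of_real_add complex_norm_square[of x])
    then show ?thesis by (simp only: of_real_eq_iff)
  qed
  define R where "R = sqrt (1 - (norm p)\<^sup>2)"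
  have "0 < 1 - (norm p)\<^sup>2"
    using norm_less_1_square[OF z] nrm[of \<zeta>, folded zw(1)] zero_le_power2[of "cmod \<zeta>"] by linarith
  then have R: "0 < R" "R\<^sup>2 = 1 - (norm p)\<^sup>2" by (simp_all add: R_def)
  define \<psi> where "\<psi> \<eta> = p + (of_real R * \<eta>) *s q" for \<eta>
  have \<psi>: "1 - (norm (\<psi> \<eta>))\<^sup>2 = R\<^sup>2 * (1 - (cmod \<eta>)\<^sup>2)" for \<eta>
    unfolding \<psi>_def nrm using R by (simp add: norm_mult power_mult_distrib algebra_simps)
  have in_ball: "\<psi> \<eta> \<in> ball 0 1 \<longleftrightarrow> cmod \<eta> < 1" for \<eta>
  proof -
    have "\<psi> \<eta> \<in> ball 0 1 \<longleftrightarrow> 0 < 1 - (norm (\<psi> \<eta>))\<^sup>2" by (simp add: abs_square_less_1)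
    also have "\<dots> \<longleftrightarrow> cmod \<eta> < 1"
      unfolding \<psi> using R(1) by (simp add: zero_less_mult_iff abs_square_less_1)
    finally show ?thesis .
  qed
  \<comment> \<open>The constant factor absorbs the powers of \<open>R\<close> by which the weights
    of the ball and of the disc differ.\<close>
  define U where "U \<eta> = of_real ((R\<^sup>2) powr (real N / 2)) * u (\<psi> \<eta>)" for \<eta>
  have weight: "(1 - (cmod \<eta>)\<^sup>2) powr (real N / 2) * cmod (U \<eta>) = (1 - (norm (\<psi> \<eta>))\<^sup>2) powr (real N / 2) * cmod (u (\<psi> \<eta>))"
    if "cmod \<eta> < 1" for \<eta>
  proof -
    have "0 < 1 - (cmod \<eta>)\<^sup>2" using that by (simp add: abs_square_less_1)
    then show ?thesis unfolding \<psi> U_def using R by (simp add: powr_mult norm_mult)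
  qed
  define \<eta>1 where "\<eta>1 = \<zeta> / of_real R"
  define \<eta>2 where "\<eta>2 = (\<zeta> + c) / of_real R"
  have \<eta>: "\<psi> \<eta>1 = z" "\<psi> \<eta>2 = w" using R zw by (simp_all add: \<psi>_def \<eta>1_def \<eta>2_def)
  have \<eta>_lt: "cmod \<eta>1 < 1" "cmod \<eta>2 < 1" using in_ball[of \<eta>1] in_ball[of \<eta>2] z w \<eta> by simp_all
  have "(1 - (cmod \<eta>2)\<^sup>2) powr (real N / 2) * cmod (U \<eta>2) - (1 - (cmod \<eta>1)\<^sup>2) powr (real N / 2) * cmod (U \<eta>1)
    \<le> sqrt (real N + 1) * ((real N + 1) / real N) powr (real N / 2) * K
        * sqrt (1 - (1 - (cmod \<eta>1)\<^sup>2) * (1 - (cmod \<eta>2)\<^sup>2) / (cmod (1 - \<eta>2 * cnj \<eta>1))\<^sup>2)"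
  proof (rule weighted_disc[OF N _ _ \<eta>_lt])
    have eq: "\<psi> \<eta> = p + \<eta> *s (of_real R *s q)" for \<eta> by (simp add: \<psi>_def mult.commute)
    have "(\<lambda>\<eta>. u (\<psi> \<eta>)) holomorphic_on ball 0 1"
      unfolding eq by (rule hol) (use in_ball in \<open>simp add: eq\<close>)
    then show "U holomorphic_on ball 0 1" unfolding U_def[abs_def] by (intro holomorphic_intros)
    show "(1 - (cmod \<eta>)\<^sup>2) powr (real N / 2) * cmod (U \<eta>) \<le> K" if "cmod \<eta> < 1" for \<eta>
      unfolding weight[OF that] using bound in_ball that by blast
  qed
  moreover have "(1 - (norm z)\<^sup>2) * (1 - (norm w)\<^sup>2) / (cmod (1 - hinner w z))\<^sup>2
      = (1 - (cmod \<eta>1)\<^sup>2) * (1 - (cmod \<eta>2)\<^sup>2) / (cmod (1 - \<eta>2 * cnj \<eta>1))\<^sup>2"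
  proof -
    have "1 - hinner w z = of_real (R\<^sup>2) * (1 - \<eta>2 * cnj \<eta>1)"
    proof -
      have "hinner w z = of_real ((norm p)\<^sup>2) + (of_real R * \<eta>2) * cnj (of_real R * \<eta>1)"
        unfolding \<eta>(1,2)[symmetric] \<psi>_def by (rule hin)
      moreover have "complex_of_real ((norm p)\<^sup>2) = 1 - of_real (R\<^sup>2)" using R by simp
      ultimately show ?thesis by (simp add: power2_eq_square algebra_simps)
    qed
    then have "cmod (1 - hinner w z) = R\<^sup>2 * cmod (1 - \<eta>2 * cnj \<eta>1)"
      by (simp add: norm_mult norm_power)
    moreover have "1 - (norm z)\<^sup>2 = R\<^sup>2 * (1 - (cmod \<eta>1)\<^sup>2)" "1 - (norm w)\<^sup>2 = R\<^sup>2 * (1 - (cmod \<eta>2)\<^sup>2)"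
      using \<psi>[of \<eta>1] \<psi>[of \<eta>2] \<eta> by simp_all
    ultimately show ?thesis using R(1) by (simp add: power_mult_distrib power2_eq_square)
  qed
  ultimately show ?thesis using weight[OF \<eta>_lt(1)] weight[OF \<eta>_lt(2)] \<eta> by simp
qed

section \<open>The distortion estimate\<close>

lemma exists_unimodular:
  obtains c :: complex where "cmod c = 1" "cmod (x + c * y) = cmod x + cmod y"
proof -
  define c where "c = (if x = 0 \<or> y = 0 then 1 else sgn x * cnj (sgn y))"
  have "cmod c = 1" by (simp add: c_def norm_mult norm_sgn)
  moreover have "cmod (x + c * y) = cmod x + cmod y"
  proof (cases "x = 0 \<or> y = 0")
    case False
    have "cnj (sgn y) * y = of_real (cmod y)"
      using False by (simp add: sgn_div_norm scaleR_conv_of_real field_simps complex_norm_square[symmetric] power2_eq_square)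
    then have "x + c * y = sgn x * of_real (cmod x + cmod y)"
      using False by (simp add: c_def sgn_div_norm scaleR_conv_of_real field_simps)
    then show ?thesis using False by (simp add: norm_mult norm_sgn flip: of_real_add)
  qed (auto simp: c_def)
  ultimately show ?thesis by (rule that)
qed

text \<open>Superadditivity of the n-th power on nonnegative reals, applied to the smaller of the
  two numbers and their difference.\<close>

lemma power_diff_le_diff_power:
  fixes A B :: real
  assumes "0 \<le> A" "0 \<le> B" "0 < n"
  shows "\<bar>A - B\<bar> ^ n \<le> \<bar>A ^ n - B ^ n\<bar>"
proof -
  have super: "x ^ n + y ^ n \<le> (x + y) ^ n" if "0 \<le> x" "0 \<le> y" for x y :: real
    using \<open>0 < n\<close>
  proof (induction n rule: nat_induct_non_zero)
    case (Suc n)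
    have "x ^ Suc n + y ^ Suc n \<le> x * (x + y) ^ n + y * (x + y) ^ n"
      using that by (auto intro!: add_mono mult_left_mono power_mono)
    then show ?case by (simp add: algebra_simps)
  qed simp
  show ?thesis
  proof (cases "B \<le> A")
    case True
    with super[of "A - B" B] assms show ?thesis by (simp add: power_mono)
  next
    case False
    with super[of "B - A" A] assms show ?thesis by (simp add: power_mono abs_if)
  qed
qed

text \<open>Since \<open>0 powr a\<close> is 0 for every \<open>a\<close>, a zero base is covered;
  it occurs where \<open>Lambda\<close> or the \<open>tanh\<close> vanishes.\<close>

lemma powr_power_nat:
  fixes x :: real
  assumes "0 < n"
  shows "(x powr a) ^ n = x powr (real n * a)"
proof (cases "x = 0")
  case False
  then show ?thesis by (rule powr_power)
qed (use assms in simp)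

theorem theorem2p7:
  fixes f :: "complex ^ 'n \<Rightarrow> complex ^ 'n"
    and z1 z2 :: "complex ^ 'n"
  assumes "f \<in> bloch_space"
    and "z1 \<in> ball 0 1" and "z2 \<in> ball 0 1"
  shows "\<bar>Dn1 f z2 - Dn1 f z1\<bar>
    \<le> M_const CARD('n) * bloch_prenorm f * tanh (bergman_dist z1 z2) powr (1 / real CARD('n))"
proof -
  define n where "n = CARD('n)"
  have n: "0 < n" by (simp add: n_def)
  obtain h g where hg: "pluri_parts f = (h, g)" by (cases "pluri_parts f")
  have "canonical_decomposition f (h, g)"
    using someI_ex[OF canonical_decomposition_exists[of f]] assms(1) hg
    by (simp add: bloch_space_def pluri_parts_def)
  then have hol: "holomorphic_map_on h (ball 0 1)" "holomorphic_map_on g (ball 0 1)"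
    by (simp_all add: canonical_decomposition_def)
  define K where "K = bloch_prenorm f"
  have bdd: "bdd_above (Dn1 f ` ball 0 1)" using assms(1) by (simp add: bloch_space_def)
  have D_le: "Dn1 f z \<le> K" if "z \<in> ball 0 1" for z
    unfolding K_def bloch_prenorm_def using that bdd by (rule cSUP_upper)
  have D_nonneg: "0 \<le> Dn1 f z" for z by (simp add: Dn1_def)
  have K: "0 \<le> K" using D_le[OF assms(2)] D_nonneg[of z1] by simp
  \<comment> \<open>The constant of \<open>weighted_ball\<close> for \<open>N = n + 1\<close>; it is
    identified with \<open>M_const n ^ n\<close> in \<open>M\<close>.\<close>
  define C where "C = sqrt (real (n + 1) + 1) * ((real (n + 1) + 1) / real (n + 1)) powr (real (n + 1) / 2)"
  have C: "0 \<le> C" by (simp add: C_def)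
  define F where "F z = (1 - (norm z)\<^sup>2) powr (real (n + 1) / 2) * Lambda f z" for z :: "complex ^ 'n"
  have \<Lambda>: "Lambda f z = cmod (det (jacobian h z)) + cmod (det (jacobian g z))" for z
    by (simp add: Lambda_def hg)
  have DF: "Dn1 f z ^ n = F z" if z: "z \<in> ball 0 1" for z
  proof -
    have pos: "0 < 1 - (norm z)\<^sup>2" by (rule norm_less_1_square[OF z])
    have "((1 - (norm z)\<^sup>2) powr ((real n + 1) / (2 * real n))) ^ n = (1 - (norm z)\<^sup>2) powr (real (n + 1) / 2)"
      unfolding powr_power_nat[OF n]
      using n by (intro arg_cong[where f = "(powr) _"]) (simp add: field_simps)
    moreover have "(Lambda f z powr (1 / real n)) ^ n = Lambda f z"
      unfolding powr_power_nat[OF n]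
      using n by (simp add: \<Lambda>)
    ultimately show ?thesis by (simp add: Dn1_def F_def n_def power_mult_distrib)
  qed
  define T where "T = tanh (bergman_dist z1 z2)"
  define \<rho> where "\<rho> = sqrt (1 - (1 - (norm z1)\<^sup>2) * (1 - (norm z2)\<^sup>2) / (cmod (1 - hinner z2 z1))\<^sup>2)"
  have "hinner z1 z2 = cnj (hinner z2 z1)" by (rule hinner_commute)
  then have cm: "cmod (1 - hinner z1 z2) = cmod (1 - hinner z2 z1)"
    by (metis complex_cnj_diff complex_cnj_one complex_mod_cnj)
  have \<rho>: "\<rho> \<le> T"
    using tanh_bergman_dist_ge[OF assms(2,3)] by (simp add: \<rho>_def T_def)
  have one_sided: "F w - F z \<le> C * K ^ n * sqrt (1 - (1 - (norm z)\<^sup>2) * (1 - (norm w)\<^sup>2) / (cmod (1 - hinner w z))\<^sup>2)"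
    if z: "z \<in> ball 0 1" and w: "w \<in> ball 0 1" for z w
  proof -
    \<comment> \<open>The choice of \<open>c\<close> depends on \<open>w\<close>: the weighted
      modulus of \<open>u\<close> equals \<open>F\<close> at \<open>w\<close> and is at most
      \<open>F\<close> elsewhere. At \<open>z\<close>, where it is subtracted, this inequality has
      the right direction.\<close>
    obtain c where c: "cmod c = 1" "cmod (det (jacobian h w) + c * det (jacobian g w)) = Lambda f w"
      unfolding \<Lambda> by (rule exists_unimodular)
    define u where "u x = det (jacobian h x) + c * det (jacobian g x)" for x
    have u_le: "(1 - (norm x)\<^sup>2) powr (real (n + 1) / 2) * cmod (u x) \<le> F x" for x
      unfolding F_def \<Lambda> u_def
      by (intro mult_left_mono norm_triangle_le) (simp_all add: norm_mult c)
    have "(1 - (norm w)\<^sup>2) powr (real (n + 1) / 2) * cmod (u w) - (1 - (norm z)\<^sup>2) powr (real (n + 1) / 2) * cmod (u z)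
      \<le> sqrt (real (n + 1) + 1) * ((real (n + 1) + 1) / real (n + 1)) powr (real (n + 1) / 2) * K ^ n
        * sqrt (1 - (1 - (norm z)\<^sup>2) * (1 - (norm w)\<^sup>2) / (cmod (1 - hinner w z))\<^sup>2)"
    proof (rule weighted_ball[where N = "n + 1" and K = "K ^ n" and u = u, OF _ _ _ z w])
      show "(\<lambda>s. u (a + s *s v)) holomorphic_on T"
        if "\<And>s. s \<in> T \<Longrightarrow> a + s *s v \<in> ball 0 1" for a v T
        unfolding u_def by (intro holomorphic_intros holomorphic_det_jacobian_on_line hol that)
      show "(1 - (norm x)\<^sup>2) powr (real (n + 1) / 2) * cmod (u x) \<le> K ^ n" if "x \<in> ball 0 1" for x
        using u_le[of x] DF[OF that] power_mono[OF D_le[OF that] D_nonneg, of n] by linarith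
    qed simp
    moreover have "(1 - (norm w)\<^sup>2) powr (real (n + 1) / 2) * cmod (u w) = F w"
      by (simp add: u_def F_def c(2))
    ultimately show ?thesis using u_le[of z] by (simp add: C_def)
  qed
  \<comment> \<open>By \<open>cm\<close>, \<open>\<rho>\<close> is symmetric in the two points, so
    the one-sided estimates in both orders combine.\<close>
  have "\<bar>F z2 - F z1\<bar> \<le> C * K ^ n * \<rho>"
    using one_sided[OF assms(2,3)] one_sided[OF assms(3,2)] unfolding cm
    by (auto simp: abs_le_iff \<rho>_def mult.commute[of "1 - (norm z2)\<^sup>2"])
  also have "\<dots> \<le> C * K ^ n * T" using C K \<rho> by (intro mult_left_mono) auto
  finally have F_le: "\<bar>F z2 - F z1\<bar> \<le> C * K ^ n * T" .
  have T: "0 \<le> T"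
  proof -
    have "1 \<le> bergman_cosh z1 z2" using assms by (intro bergman_cosh_ge_1)
    then have "0 \<le> bergman_dist z1 z2"
      using arcosh_bergman_cosh_le_dist[OF assms(2,3)] arcosh_nonneg_real order_trans by blast
    then show ?thesis by (simp add: T_def)
  qed
  have M: "M_const n ^ n = C"
  proof -
    have "((real n + 2) powr (1 / (2 * real n))) ^ n = sqrt (real (n + 1) + 1)"
      unfolding powr_power_nat[OF n]
      using n by (simp add: powr_half_sqrt[symmetric] add_ac)
    moreover have "(((real n + 2) / (real n + 1)) powr ((real n + 1) / (2 * real n))) ^ n
        = ((real (n + 1) + 1) / real (n + 1)) powr (real (n + 1) / 2)"
      unfolding powr_power_nat[OF n]
      using n by (intro arg_cong2[where f = "(powr)"]) (simp_all add: field_simps)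
    ultimately show ?thesis by (simp add: M_const_def C_def power_mult_distrib)
  qed
  have T_root: "(T powr (1 / real n)) ^ n = T"
    unfolding powr_power_nat[OF n]
    using n T by simp
  have "\<bar>Dn1 f z2 - Dn1 f z1\<bar> ^ n \<le> \<bar>Dn1 f z2 ^ n - Dn1 f z1 ^ n\<bar>"
    by (rule power_diff_le_diff_power[OF D_nonneg D_nonneg n])
  also have "\<dots> \<le> C * K ^ n * T" using F_le DF assms by simp
  also have "\<dots> = (M_const n * K * T powr (1 / real n)) ^ n"
    by (simp add: power_mult_distrib M T_root)
  finally have "\<bar>Dn1 f z2 - Dn1 f z1\<bar> \<le> M_const n * K * T powr (1 / real n)"
    using n K by (subst (asm) power_mono_iff) (simp_all add: M_const_def)
  then show ?thesis by (simp add: n_def K_def T_def)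
qed

end
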